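(* Let $0<\rho_0<\rho_1<1$. The family of functionals $\{S_\varepsilon\}$, $S_\varepsilon:M\to[0,+\infty)$, $\Gamma$-converges to $S$ in $M$ as $\varepsilon\downarrow0$. In particular, the functional $S:M\to[0,+\infty)$ is lower semicontinuous.
   Context: $M=\{\rho\in L^\infty([0,1]):0\le\rho\le1\}$ with the relative weak* topology of $L^\infty=(L^1)^*$ (a compact Polish space). $\varphi_i=\log[\rho_i/(1-\rho_i)]$, $i=0,1$, and $\varepsilon_0=1/(\varphi_1-\varphi_0)$; $S_\varepsilon$ is considered for $\varepsilon\in(0,\varepsilon_0)$. $\mathcal F$ is the set of functions $\varphi(x)=\varphi_0+\mu([0,x])$, $x\in[0,1]$, with $\mu=d\varphi$ a positive Borel measure on $[0,1]$ of total mass $\varphi_1-\varphi_0$. $s(a)=a\log a+(1-a)\log(1-a)$ for $a\in[0,1]$ (with $0\log 0=0$), $s(a)=+\infty$ otherwise. Positive viscosity: $$\mathcal G_\varepsilon(\rho,\varphi)=\int_0^1\big[s(\rho)+s(\varepsilon\varphi_x)+(1-\rho)\varphi-\log(1+e^\varphi)\big]dx,$$ with $\mathcal G_\varepsilon(\rho,\varphi)=+\infty$ unless $d\varphi$ is absolutely continuous with density $\varphi_x$ bounded by $\varepsilon^{-1}$; $S^o_\varepsilon(\rho)=\inf_{\varphi\in\mathcal F}\mathcal G_\varepsilon(\rho,\varphi)$; $S_\varepsilon(\rho)=S^o_\varepsilon(\rho)-S^o_\varepsilon(\bar\rho_\varepsilon)$. Here, with $f(a)=a(1-a)$ and $J_\varepsilon$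 the unique number in $(-\infty,\min_{[\rho_0,\rho_1]}f)$ such that $\int_{\rho_0}^{\rho_1}\frac{\varepsilon}{f(r)-J_\varepsilon}dr=1$, $\bar\rho_\varepsilon$ solves $f(\bar\rho_\varepsilon)-\varepsilon(\bar\rho_\varepsilon)_x=J_\varepsilon$ on $[0,1]$, $\bar\rho_\varepsilon(0)=\rho_0$ (so $\bar\rho_\varepsilon(1)=\rho_1$). Zero viscosity: $$\mathcal G(\rho,\varphi)=\int_0^1\big[s(\rho)+(1-\rho)\varphi-\log(1+e^\varphi)\big]dx,\quad S^o(\rho)=\inf_{\varphi\in\mathcal F}\mathcal G(\rho,\varphi),\quad S(\rho)=S^o(\rho)-S^o(\bar\rho).$$ Here $\bar\rho$ is a stationary entropic solution of the inviscid Burgers equation: $\bar\rho\equiv\rho_0$ if $\rho_0+\rho_1<1$; $\bar\rho\equiv\rho_1$ if $\rho_0+\rho_1>1$; if $\rho_0+\rho_1=1$, $\bar\rho$ is any of the functions $\bar\rho_\alpha=\rho_0\mathbf 1_{[0,\alpha)}+\rho_1\mathbf 1_{[\alpha,1]}$, $\alpha\in[0,1]$ (the value $S^o(\bar\rho_\alpha)$ does not depend on $\alpha$). $\Gamma$-convergence: a sequence $F_n:X\to(-\infty,+\infty]$ on a Polish space $X$ $\Gamma$-converges to $F:X\to(-\infty,+\infty]$ if for each $x\in X$: there is a sequence $x_n\to x$ with $\limsup_nF_n(x_n)\le F(x)$, and for any sequence $x_n\to x$, $\liminf_nF_n(x_n)\ge F(x)$. A family indexed by $\varepsilon$ $\Gamma$-converges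 as $\varepsilon\downarrow0$ if this holds along every sequence $\varepsilon_n\downarrow0$. *)

theory Defs
  imports "HOL-Analysis.Analysis" "HOL-Library.FuncSet"
begin

section \<open>Gamma-convergence and lower semicontinuity\<close>

definition Gamma_converges :: "'a topology \<Rightarrow> (nat \<Rightarrow> 'a \<Rightarrow> ereal) \<Rightarrow> ('a \<Rightarrow> ereal) \<Rightarrow> bool" where
  "Gamma_converges X F G \<longleftrightarrow>
    (\<forall>x\<in>topspace X.
      (\<exists>u. (\<forall>n. u n \<in> topspace X) \<and> limitin X u x sequentially \<and>
           limsup (\<lambda>n. F n (u n)) \<le> G x) \<and>
      (\<forall>u. (\<forall>n. u n \<in> topspace X) \<and> limitin X u x sequentially \<longrightarrow>
           G x \<le> liminf (\<lambda>n. F n (u n))))"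

text \<open>The family is indexed by the parameters in \<open>{0<..<e0}\<close>.\<close>
definition Gamma_converges_at_0 ::
    "'a topology \<Rightarrow> real \<Rightarrow> (real \<Rightarrow> 'a \<Rightarrow> ereal) \<Rightarrow> ('a \<Rightarrow> ereal) \<Rightarrow> bool" where
  "Gamma_converges_at_0 X e0 F G \<longleftrightarrow>
    (\<forall>e :: nat \<Rightarrow> real. (\<forall>n. e n \<in> {0<..<e0}) \<and> e \<longlonglongrightarrow> 0 \<longrightarrow>
       Gamma_converges X (\<lambda>n. F (e n)) G)"

definition lower_semicontinuous_map :: "'a topology \<Rightarrow> ('a \<Rightarrow> ereal) \<Rightarrow> bool" where
  "lower_semicontinuous_map X F \<longleftrightarrow> (\<forall>a. openin X {x \<in> topspace X. a < F x})"

section \<open>The space of density profiles\<close>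

definition unit_leb :: "real measure" where
  "unit_leb = restrict_space lborel {0..1}"

definition ess_bounded :: "(real \<Rightarrow> real) \<Rightarrow> bool" where
  "ess_bounded r \<longleftrightarrow> r \<in> borel_measurable unit_leb \<and> (\<exists>C. AE x in unit_leb. \<bar>r x\<bar> \<le> C)"

definition linf_rel :: "(real \<Rightarrow> real) \<Rightarrow> (real \<Rightarrow> real) \<Rightarrow> bool" where
  "linf_rel r s \<longleftrightarrow> ess_bounded r \<and> ess_bounded s \<and> (AE x in unit_leb. r x = s x)"

text \<open>\<open>L\<^sup>\<infinity>([0,1])\<close>: essentially bounded functions modulo almost everywhere equality.\<close>
quotient_type linf = "real \<Rightarrow> real" / partial: linf_rel
proof (rule part_equivpI)
  have "ess_bounded (\<lambda>_. 0)"
    unfolding ess_bounded_def by auto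
  then show "\<exists>r. linf_rel r r"
    unfolding linf_rel_def by auto
  show "symp linf_rel"
    unfolding symp_def linf_rel_def by (auto elim: eventually_mono)
  show "transp linf_rel"
    unfolding transp_def linf_rel_def by (auto elim: eventually_elim2)
qed

text \<open>The duality between \<open>L\<^sup>1\<close> and \<open>L\<^sup>\<infinity>\<close>. The guard makes the value independent of the
  representative for every function \<open>g\<close>; only integrable \<open>g\<close> are used below.\<close>
lift_definition pairing :: "(real \<Rightarrow> real) \<Rightarrow> linf \<Rightarrow> real"
  is "\<lambda>g r. if integrable unit_leb g then LINT x|unit_leb. r x * g x else 0"
  by (auto simp: linf_rel_def ess_bounded_def intro!: integral_cong_AE)

definition weak_star :: "linf topology" where
  "weak_star = topology_generated_by
     {{r. pairing g r \<in> U} |g U. integrable unit_leb g \<and> open U}"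

lift_definition zero_one_valued :: "linf \<Rightarrow> bool"
  is "\<lambda>r. AE x in unit_leb. 0 \<le> r x \<and> r x \<le> 1"
  by (rule iffI; (auto simp: linf_rel_def elim: eventually_elim2))

definition M_set :: "linf set" where
  "M_set = {r. zero_one_valued r}"

definition M_top :: "linf topology" where
  "M_top = subtopology weak_star M_set"

section \<open>Boundary data and the set of auxiliary functions\<close>

definition bdry_phi :: "real \<Rightarrow> real" where
  "bdry_phi r = ln (r / (1 - r))"

definition eps0 :: "real \<Rightarrow> real \<Rightarrow> real" where
  "eps0 \<rho>0 \<rho>1 = 1 / (bdry_phi \<rho>1 - bdry_phi \<rho>0)"

text \<open>\<open>\<mu>\<close> is a positive Borel measure on \<open>[0,1]\<close>; it may charge the endpoints, in particular
  \<open>\<phi> 0 = \<phi>\<^sub>0 + \<mu>({0})\<close>. Values of \<open>\<phi>\<close> outside \<open>[0,1]\<close> are never used.\<close>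
definition is_differential :: "real \<Rightarrow> (real \<Rightarrow> real) \<Rightarrow> real measure \<Rightarrow> bool" where
  "is_differential \<rho>0 \<phi> \<mu> \<longleftrightarrow>
     sets \<mu> = sets (restrict_space borel {0..1}) \<and> finite_measure \<mu> \<and>
     (\<forall>x\<in>{0..1}. \<phi> x = bdry_phi \<rho>0 + measure \<mu> {0..x})"

definition F_set :: "real \<Rightarrow> real \<Rightarrow> (real \<Rightarrow> real) set" where
  "F_set \<rho>0 \<rho>1 = {\<phi>. \<exists>\<mu>. is_differential \<rho>0 \<phi> \<mu> \<and>
     measure \<mu> {0..1} = bdry_phi \<rho>1 - bdry_phi \<rho>0}"

text \<open>The differential is determined by \<open>\<phi>\<close>, since the intervals \<open>{0..x}\<close> generate the
  Borel sets of \<open>[0,1]\<close>.\<close>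
definition differential :: "real \<Rightarrow> (real \<Rightarrow> real) \<Rightarrow> real measure" where
  "differential \<rho>0 \<phi> = (THE \<mu>. is_differential \<rho>0 \<phi> \<mu>)"

definition phi_x :: "real \<Rightarrow> (real \<Rightarrow> real) \<Rightarrow> real \<Rightarrow> real" where
  "phi_x \<rho>0 \<phi> x = enn2real (RN_deriv unit_leb (differential \<rho>0 \<phi>) x)"

section \<open>The functionals\<close>

text \<open>HOL's \<open>ln 0 = 0\<close> gives the convention \<open>0 log 0 = 0\<close>.\<close>
definition s_ent :: "real \<Rightarrow> ereal" where
  "s_ent a = (if 0 \<le> a \<and> a \<le> 1 then ereal (a * ln a + (1 - a) * ln (1 - a)) else \<infinity>)"

text \<open>Lebesgue integral of an extended real function as the difference of the integrals of its
  positive and negative parts (\<open>e2ennreal\<close> truncates negative values to 0). For the integrands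
  below the negative part is essentially bounded.\<close>
definition ext_integral :: "(real \<Rightarrow> ereal) \<Rightarrow> ereal" where
  "ext_integral h =
     enn2ereal (\<integral>\<^sup>+x. e2ennreal (h x) \<partial>unit_leb) - enn2ereal (\<integral>\<^sup>+x. e2ennreal (- h x) \<partial>unit_leb)"

lemma ext_integral_cong_AE:
  assumes "AE x in unit_leb. g x = h x"
  shows "ext_integral g = ext_integral h"
proof -
  have "(\<integral>\<^sup>+x. e2ennreal (g x) \<partial>unit_leb) = (\<integral>\<^sup>+x. e2ennreal (h x) \<partial>unit_leb)"
    using assms by (intro nn_integral_cong_AE) (auto elim: eventually_mono)
  moreover have "(\<integral>\<^sup>+x. e2ennreal (- g x) \<partial>unit_leb) = (\<integral>\<^sup>+x. e2ennreal (- h x) \<partial>unit_leb)"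
    using assms by (intro nn_integral_cong_AE) (auto elim: eventually_mono)
  ultimately show ?thesis
    by (simp add: ext_integral_def)
qed

lift_definition G_visc :: "real \<Rightarrow> real \<Rightarrow> linf \<Rightarrow> (real \<Rightarrow> real) \<Rightarrow> ereal"
  is "\<lambda>\<rho>0 \<epsilon> \<rho> \<phi>.
    if absolutely_continuous unit_leb (differential \<rho>0 \<phi>) \<and>
       (AE x in unit_leb. RN_deriv unit_leb (differential \<rho>0 \<phi>) x \<le> ennreal (1 / \<epsilon>))
    then ext_integral (\<lambda>x. s_ent (\<rho> x) + s_ent (\<epsilon> * phi_x \<rho>0 \<phi> x)
           + ereal ((1 - \<rho> x) * \<phi> x - ln (1 + exp (\<phi> x))))
    else \<infinity>"
  unfolding linf_rel_def
  by (intro ext if_cong refl ext_integral_cong_AE) (auto elim: eventually_mono)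

definition So_visc :: "real \<Rightarrow> real \<Rightarrow> real \<Rightarrow> linf \<Rightarrow> ereal" where
  "So_visc \<rho>0 \<rho>1 \<epsilon> \<rho> = (INF \<phi>\<in>F_set \<rho>0 \<rho>1. G_visc \<rho>0 \<epsilon> \<rho> \<phi>)"

lift_definition G_inv :: "linf \<Rightarrow> (real \<Rightarrow> real) \<Rightarrow> ereal"
  is "\<lambda>\<rho> \<phi>. ext_integral (\<lambda>x. s_ent (\<rho> x) + ereal ((1 - \<rho> x) * \<phi> x - ln (1 + exp (\<phi> x))))"
  unfolding linf_rel_def
  by (intro ext ext_integral_cong_AE) (auto elim: eventually_mono)

definition So_inv :: "real \<Rightarrow> real \<Rightarrow> linf \<Rightarrow> ereal" where
  "So_inv \<rho>0 \<rho>1 \<rho> = (INF \<phi>\<in>F_set \<rho>0 \<rho>1. G_inv \<rho> \<phi>)"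

section \<open>Stationary solutions and normalized functionals\<close>

definition flux :: "real \<Rightarrow> real" where
  "flux a = a * (1 - a)"

definition J_visc :: "real \<Rightarrow> real \<Rightarrow> real \<Rightarrow> real" where
  "J_visc \<rho>0 \<rho>1 \<epsilon> = (THE J. J < (INF r\<in>{\<rho>0..\<rho>1}. flux r) \<and>
     ((\<lambda>r. \<epsilon> / (flux r - J)) has_integral 1) {\<rho>0..\<rho>1})"

text \<open>The derivatives at 0 and 1 are one-sided; restricting to \<open>extensional {0..1}\<close> makes the
  solution unique as a function on the real line.\<close>
definition rho_visc :: "real \<Rightarrow> real \<Rightarrow> real \<Rightarrow> real \<Rightarrow> real" where
  "rho_visc \<rho>0 \<rho>1 \<epsilon> = (THE r. r \<in> extensional {0..1} \<and> r 0 = \<rho>0 \<and>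
     (\<forall>x\<in>{0..1}. \<exists>d. (r has_real_derivative d) (at x within {0..1}) \<and>
        flux (r x) - \<epsilon> * d = J_visc \<rho>0 \<rho>1 \<epsilon>))"

definition S_visc :: "real \<Rightarrow> real \<Rightarrow> real \<Rightarrow> linf \<Rightarrow> ereal" where
  "S_visc \<rho>0 \<rho>1 \<epsilon> \<rho> =
     So_visc \<rho>0 \<rho>1 \<epsilon> \<rho> - So_visc \<rho>0 \<rho>1 \<epsilon> (abs_linf (rho_visc \<rho>0 \<rho>1 \<epsilon>))"

text \<open>The admissible choices of the inviscid stationary entropic solution; there is more than one
  only when \<open>\<rho>0 + \<rho>1 = 1\<close>.\<close>
definition stationary_inv :: "real \<Rightarrow> real \<Rightarrow> linf set" where
  "stationary_inv \<rho>0 \<rho>1 =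
     (if \<rho>0 + \<rho>1 < 1 then {abs_linf (\<lambda>_. \<rho>0)}
      else if \<rho>0 + \<rho>1 > 1 then {abs_linf (\<lambda>_. \<rho>1)}
      else {abs_linf (\<lambda>x. \<rho>0 * indicator {0..<\<alpha>} x + \<rho>1 * indicator {\<alpha>..1} x) |\<alpha>. \<alpha> \<in> {0..1}})"

definition S_inv :: "real \<Rightarrow> real \<Rightarrow> linf \<Rightarrow> linf \<Rightarrow> ereal" where
  "S_inv \<rho>0 \<rho>1 \<rho>bar \<rho> = So_inv \<rho>0 \<rho>1 \<rho> - So_inv \<rho>0 \<rho>1 \<rho>bar"

end

theory Submission
  imports Defs "HOL-Probability.Distribution_Functions" "HOL-Probability.Giry_Monad"
begin

text \<open>Write \<open>m\<close> for the total mass \<open>\<phi>1 - \<phi>0\<close>. For admissible \<open>\<phi>\<close> the viscous functional differs from the inviscid one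
  only by the term \<open>\<integral> s(\<epsilon>\<phi>\<^sub>x)\<close>, which is at most 0, and at least \<open>s(\<epsilon>m)\<close> by convexity; moreover every \<open>\<phi>\<close>
  can be mollified into one with slope at most \<open>1/\<epsilon>\<close> at \<open>L\<^sup>1\<close>-distance at most \<open>\<epsilon>m\<^sup>2\<close>. Hence the infima over
  \<open>\<phi>\<close> differ by \<open>O(\<epsilon>m\<^sup>2 + \<bar>s(\<epsilon>m)\<bar>)\<close>, uniformly in \<open>\<rho>\<close>, and so do their minima over \<open>\<rho>\<close>.

  The inviscid infimum is \<open>\<integral> s(\<rho>)\<close>, which is lower semicontinuous by convexity, plus an infimum of
  functionals that are weak* continuous uniformly in \<open>\<phi>\<close>. The normalizing constants are identified as
  minima: pointwise minimization in \<open>\<rho>\<close> leaves \<open>log F(\<phi>)\<close>, where \<open>F(\<phi>)\<close> is the flux at the density with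
  chemical potential \<open>\<phi>\<close>, and the remaining one-dimensional variational problem for
  \<open>s(\<epsilon>\<phi>\<^sub>x) + log F(\<phi>)\<close> is solved by a calibration.\<close>

section \<open>Binary entropy and measures on the unit interval\<close>

text \<open>The two normalizing constants are values at different profiles, \<open>rho_visc\<close>
  and \<open>\<rho>bar\<close>, so closeness of the unnormalized infima at one common profile does
  not yet compare them. Knowing that both are minima over \<rho> does, and it also gives
  nonnegativity.

  An infimum over \<phi> of lower semicontinuous functionals need not be lower semicontinuous, and
  (1 - \<rho>) \<phi> is a product of two varying factors. Both difficulties are met by the fixed
  total variation of \<phi>: integration by parts reduces the product to integrals of \<rho> over
  intervals [y,1], with bounds independent of \<phi>.

  Competitors in the viscous problem are only Lipschitz, with a measurable slope. The calibration
  compares them with the stationary solution through integrals of \<open>\<phi>\<^sub>x\<close>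
  w(\<phi>), which depend only on the boundary values of \<phi>. Together with a constant, this
  expression bounds the integrand from below, with equality along the stationary solution.\<close>

definition ent :: "real \<Rightarrow> real" where
  "ent a = a * ln a + (1 - a) * ln (1 - a)"

lemma s_ent_eq: "0 \<le> a \<Longrightarrow> a \<le> 1 \<Longrightarrow> s_ent a = ereal (ent a)"
  by (simp add: s_ent_def ent_def)

lemma ent_nonpos: "0 \<le> a \<Longrightarrow> a \<le> 1 \<Longrightarrow> ent a \<le> 0"
  unfolding ent_def by (cases "a = 0"; cases "a = 1") (auto intro!: add_nonpos_nonpos mult_nonneg_nonpos)

lemma ent_symmetric: "ent (1 - a) = ent a"
  by (simp add: ent_def)

lemma measurable_ent [measurable]: "ent \<in> borel_measurable borel"
  unfolding ent_def[abs_def] by measurable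

text \<open>Nonnegativity of the relative entropy of two Bernoulli laws, from ln y \<le> y - 1 for
  each outcome. Equivalently, the tangent of \<open>ent\<close> at q lies below the graph; convexity
  of the entropy enters in this form.\<close>

lemma gibbs:
  assumes "0 \<le> a" "a \<le> 1" "0 < q" "q < 1"
  shows "a * ln q + (1 - a) * ln (1 - q) \<le> ent a"
proof -
  have *: "a * ln q - a * ln a \<le> q - a" if "0 \<le> a" "0 < q" for a q :: real
  proof (cases "a = 0")
    case False
    with that have "ln (q / a) \<le> q / a - 1" by (intro ln_le_minus_one) auto
    then have "a * ln (q / a) \<le> a * (q / a - 1)"
      using that by (intro mult_left_mono) auto
    with that False show ?thesis by (simp add: ln_div algebra_simps)
  qed (use that in simp)
  show ?thesis using *[of a q] *[of "1 - a" "1 - q"] assms unfolding ent_def by simp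
qed

lemma ent_ge: "0 \<le> a \<Longrightarrow> a \<le> 1 \<Longrightarrow> - 1 \<le> ent a"
proof -
  assume "0 \<le> a" "a \<le> 1"
  have "- ln (2::real) = a * ln (1/2) + (1 - a) * ln (1 - 1/2)"
    by (simp add: ln_div algebra_simps)
  also have "\<dots> \<le> ent a" by (rule gibbs) (use \<open>0 \<le> a\<close> \<open>a \<le> 1\<close> in auto)
  finally show ?thesis using ln_le_minus_one[of 2] by simp
qed

lemma ent_tendsto_0: "(ent \<longlongrightarrow> 0) (at_right 0)"
proof -
  have "\<bar>ent a\<bar> \<le> 2 * sqrt a + \<bar>ln (1 - a)\<bar>" if "0 < a" "a < 1" for a :: real
  proof -
    \<comment> \<open>Using ln y \<le> y - 1 at 1 / sqrt a yields a bound that vanishes with a; at 1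
      / a it would only show that a ln a is bounded.\<close>
    have "ln (1 / sqrt a) \<le> 1 / sqrt a - 1" using that by (intro ln_le_minus_one) auto
    then have "- ln (sqrt a) \<le> 1 / sqrt a" using that by (simp add: ln_div)
    then have "a * (- ln (sqrt a)) \<le> a * (1 / sqrt a)" using that by (intro mult_left_mono) auto
    also have "a * (1 / sqrt a) = sqrt a" using that by (simp add: real_div_sqrt)
    finally have "- (a * ln a) \<le> 2 * sqrt a"
      using that by (simp add: ln_sqrt)
    moreover have "a * ln a \<le> 0"
      using that by (intro mult_nonneg_nonpos) auto
    ultimately have "\<bar>a * ln a\<bar> \<le> 2 * sqrt a"
      by linarith
    moreover have "\<bar>(1 - a) * ln (1 - a)\<bar> \<le> 1 * \<bar>ln (1 - a)\<bar>"
      unfolding abs_mult using that by (intro mult_right_mono) auto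
    ultimately show ?thesis unfolding ent_def by linarith
  qed
  then have "eventually (\<lambda>a. norm (ent a) \<le> 2 * sqrt a + \<bar>ln (1 - a)\<bar>) (at_right 0)"
    by (intro eventually_at_rightI[of 0 1]) auto
  moreover have "((\<lambda>a::real. 2 * sqrt a + \<bar>ln (1 - a)\<bar>) \<longlongrightarrow> 2 * sqrt 0 + \<bar>ln (1 - 0)\<bar>) (at_right 0)"
    by (intro tendsto_intros) auto
  then have "((\<lambda>a::real. 2 * sqrt a + \<bar>ln (1 - a)\<bar>) \<longlongrightarrow> 0) (at_right 0)" by simp
  ultimately show ?thesis by (rule Lim_null_comparison)
qed

section \<open>Lebesgue measure on the unit interval, differentials and representatives\<close>

lemma space_unit_leb [simp]: "space unit_leb = {0..1}"
  by (simp add: unit_leb_def space_restrict_space)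

lemma sets_unit_leb [measurable_cong]: "sets unit_leb = sets (restrict_space borel {0..1})"
  by (simp add: unit_leb_def sets_restrict_space)

lemma in_sets_unit_leb: "A \<in> sets borel \<Longrightarrow> A \<subseteq> {0..1} \<Longrightarrow> A \<in> sets unit_leb"
  by (auto simp: sets_unit_leb sets_restrict_space)

lemma borel_measurable_unit_leb:
  "f \<in> borel_measurable borel \<Longrightarrow> f \<in> borel_measurable unit_leb"
  by (simp add: unit_leb_def measurable_restrict_space1)

lemma measure_unit_leb: "A \<in> sets borel \<Longrightarrow> A \<subseteq> {0..1} \<Longrightarrow> measure unit_leb A = measure lborel A"
  unfolding unit_leb_def by (rule measure_restrict_space) auto

lemma emeasure_unit_leb: "A \<in> sets borel \<Longrightarrow> A \<subseteq> {0..1} \<Longrightarrow> emeasure unit_leb A = emeasure lborel A"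
  unfolding unit_leb_def by (rule emeasure_restrict_space) auto

interpretation unit_leb: prob_space unit_leb
  by (rule prob_spaceI) (simp add: emeasure_unit_leb)

lemma integral_unit_leb: "(LINT x|unit_leb. f x) = (LINT x:{0..1}|lborel. f x)"
  for f :: "real \<Rightarrow> real"
  unfolding unit_leb_def set_lebesgue_integral_def by (subst integral_restrict_space) auto

lemma integrable_unit_leb_bounded:
  fixes f :: "real \<Rightarrow> real"
  assumes "f \<in> borel_measurable unit_leb" "\<And>x. x \<in> {0..1} \<Longrightarrow> \<bar>f x\<bar> \<le> C"
  shows "integrable unit_leb f"
  using assms by (intro unit_leb.integrable_const_bound[of _ C]) auto

lemma ext_integral_ereal:
  assumes "integrable unit_leb f" "\<And>x. x \<in> {0..1} \<Longrightarrow> g x = ereal (f x)"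
  shows "ext_integral g = ereal (LINT x|unit_leb. f x)"
proof -
  have 1: "(\<integral>\<^sup>+x. e2ennreal (g x) \<partial>unit_leb) = (\<integral>\<^sup>+x. ennreal (f x) \<partial>unit_leb)"
    using assms(2) by (intro nn_integral_cong) (simp add: ennreal_def)
  have 2: "(\<integral>\<^sup>+x. e2ennreal (- g x) \<partial>unit_leb) = (\<integral>\<^sup>+x. ennreal (- f x) \<partial>unit_leb)"
    using assms(2) by (intro nn_integral_cong) (simp add: ennreal_def)
  have fin: "(\<integral>\<^sup>+x. ennreal (f x) \<partial>unit_leb) \<noteq> \<infinity>" "(\<integral>\<^sup>+x. ennreal (- f x) \<partial>unit_leb) \<noteq> \<infinity>"
    using assms(1) by (auto simp: real_integrable_def)
  have *: "enn2ereal x = ereal (enn2real x)" if "x \<noteq> \<infinity>" for x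
    using that by (cases x) (auto simp: enn2ereal_ennreal)
  show ?thesis
    unfolding ext_integral_def 1 2 real_lebesgue_integral_def[OF assms(1)]
    by (simp add: *[OF fin(1)] *[OF fin(2)])
qed

text \<open>Pushed forward to the line, a measure on [0,1] has a distribution function given by its
  initial segments, and this function determines a finite Borel measure. It gives the definite
  description in \<open>differential\<close> its meaning.\<close>

lemma measure_eqI_initial_segments:
  fixes M N :: "real measure"
  assumes M: "sets M = sets (restrict_space borel {0..1})" "finite_measure M"
    and N: "sets N = sets (restrict_space borel {0..1})" "finite_measure N"
    and eq: "\<And>x. x \<in> {0..1} \<Longrightarrow> measure M {0..x} = measure N {0..x}"
  shows "M = N"
proof -
  have sp: "space K = {0..1}" if "sets K = sets (restrict_space borel {0..1::real})" for K
    using sets_eq_imp_space_eq[OF that] by (simp add: space_restrict_space)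
  have meas: "(\<lambda>x. x) \<in> measurable K borel" if "sets K = sets (restrict_space borel {0..1::real})" for K
    unfolding measurable_cong_sets[OF that refl] by (intro measurable_restrict_space1) simp
  let ?D = "\<lambda>K. distr K borel (\<lambda>x. x)"
  have fb: "finite_borel_measure (?D K)"
    if "sets K = sets (restrict_space borel {0..1::real})" "finite_measure K" for K
    using finite_measure.finite_measure_distr[OF that(2) meas[OF that(1)]]
    by (simp add: finite_borel_measure_def finite_borel_measure_axioms_def)
  have cdf: "cdf (?D K) t = (if t < 0 then 0 else measure K {0..min t 1})"
    if K: "sets K = sets (restrict_space borel {0..1::real})" for K t
  proof -
    have "cdf (?D K) t = measure K ({..t} \<inter> {0..1})"
      unfolding cdf_def by (subst measure_distr[OF meas[OF K]]) (auto simp: sp[OF K])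
    moreover have "{..t} \<inter> {0..1} = (if t < 0 then {} else {0..min t 1})" by auto
    ultimately show ?thesis by simp
  qed
  have "?D M = ?D N"
    by (intro cdf_unique' fb M N ext) (auto simp: cdf[OF M(1)] cdf[OF N(1)] eq)
  show ?thesis
  proof (rule measure_eqI)
    fix A assume A: "A \<in> sets M"
    then have A': "A \<in> sets borel" "A \<subseteq> {0..1}"
      by (auto simp: M(1) sets_restrict_space)
    have "emeasure (?D K) A = emeasure K A"
      if K: "sets K = sets (restrict_space borel {0..1::real})" for K
      using A' by (subst emeasure_distr[OF meas[OF K]]) (auto simp: sp[OF K] Int_absorb2)
    then show "emeasure M A = emeasure N A"
      using \<open>?D M = ?D N\<close> M(1) N(1) by metis
  qed (simp add: M N)
qed

lemma differential_eq:
  assumes "is_differential \<rho>0 \<phi> \<mu>"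
  shows "differential \<rho>0 \<phi> = \<mu>"
  unfolding differential_def
proof (rule the_equality[of "is_differential \<rho>0 \<phi>", OF assms])
  fix \<nu> assume "is_differential \<rho>0 \<phi> \<nu>"
  with assms show "\<nu> = \<mu>"
    unfolding is_differential_def
    by (intro measure_eqI_initial_segments[of \<nu> \<mu>]) auto
qed

text \<open>Representatives bounded at every point of [0,1], so that pointwise inequalities can be
  integrated directly.\<close>

definition profile :: "(real \<Rightarrow> real) \<Rightarrow> bool" where
  "profile r \<longleftrightarrow> r \<in> borel_measurable unit_leb \<and> (\<forall>x\<in>{0..1}. 0 \<le> r x \<and> r x \<le> 1)"

lemma profile_ess_bounded: "profile r \<Longrightarrow> ess_bounded r"
  unfolding profile_def ess_bounded_def by (auto intro!: exI[of _ 1] AE_I2)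

lemma profile_linf_rel: "profile r \<Longrightarrow> linf_rel r r"
  by (simp add: linf_rel_def profile_ess_bounded)

lemma abs_linf_profile_in_M: "profile r \<Longrightarrow> abs_linf r \<in> M_set"
  unfolding M_set_def mem_Collect_eq
  by (subst zero_one_valued.abs_eq[OF profile_linf_rel]) (auto simp: profile_def intro!: AE_I2)

lemma M_set_profile:
  assumes "\<rho> \<in> M_set"
  obtains r where "profile r" "\<rho> = abs_linf r"
proof -
  obtain r0 where r0: "linf_rel r0 r0" "\<rho> = abs_linf r0"
    by (metis Quotient_linf Quotient_abs_rep Quotient_rep_reflp)
  have m [measurable]: "r0 \<in> borel_measurable unit_leb"
    using r0(1) by (simp add: linf_rel_def ess_bounded_def)
  have ae: "AE x in unit_leb. 0 \<le> r0 x \<and> r0 x \<le> 1"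
    using assms zero_one_valued.abs_eq[OF r0(1)] by (simp add: M_set_def r0(2))
  define r where "r x = max 0 (min 1 (r0 x))" for x
  have r: "profile r" unfolding profile_def r_def by auto
  have "linf_rel r0 r"
    using r0(1) profile_ess_bounded[OF r] ae by (auto simp: linf_rel_def r_def)
  then have "abs_linf r0 = abs_linf r"
    by (metis Quotient_linf Quotient_rel_abs)
  with r r0 that show thesis by blast
qed

lemma pairing_abs:
  assumes "profile r" "integrable unit_leb g"
  shows "pairing g (abs_linf r) = (LINT x|unit_leb. r x * g x)"
  using assms by (simp add: pairing.abs_eq[OF profile_linf_rel])

section \<open>The functionals on representatives\<close>

lemma emeasure_density_unit_leb:
  assumes g: "g \<in> borel_measurable unit_leb" "\<And>x. x \<in> {0..1} \<Longrightarrow> 0 \<le> g x \<and> g x \<le> B"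
    and A: "A \<in> sets unit_leb"
  shows "emeasure (density unit_leb (\<lambda>x. ennreal (g x))) A = ennreal (LINT y|unit_leb. indicator A y * g y)"
proof -
  have [measurable]: "g \<in> borel_measurable unit_leb" "A \<in> sets unit_leb" by fact+
  have "emeasure (density unit_leb (\<lambda>x. ennreal (g x))) A = (\<integral>\<^sup>+y. ennreal (g y) * indicator A y \<partial>unit_leb)"
    by (rule emeasure_density) auto
  also have "\<dots> = (\<integral>\<^sup>+y. ennreal (indicator A y * g y) \<partial>unit_leb)"
    by (intro nn_integral_cong) (auto split: split_indicator)
  also have "\<dots> = ennreal (LINT y|unit_leb. indicator A y * g y)"
  proof (rule nn_integral_eq_integral)
    show "integrable unit_leb (\<lambda>y. indicator A y * g y)"
      by (rule integrable_unit_leb_bounded[of _ B]) (use g(2) in \<open>force split: split_indicator\<close>)+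
  qed (use g(2) in \<open>auto intro!: AE_I2 split: split_indicator\<close>)
  finally show ?thesis .
qed

definition Ent :: "(real \<Rightarrow> real) \<Rightarrow> real" where
  "Ent r = (LINT x|unit_leb. ent (r x))"

definition coupling :: "(real \<Rightarrow> real) \<Rightarrow> (real \<Rightarrow> real) \<Rightarrow> real" where
  "coupling r \<phi> = (LINT x|unit_leb. (1 - r x) * \<phi> x - ln (1 + exp (\<phi> x)))"

lemma profile_measurable: "profile r \<Longrightarrow> r \<in> borel_measurable unit_leb"
  and profile_bounds: "profile r \<Longrightarrow> x \<in> {0..1} \<Longrightarrow> 0 \<le> r x \<and> r x \<le> 1"
  by (auto simp: profile_def)

lemma integrable_ent:
  assumes "profile r"
  shows "integrable unit_leb (\<lambda>x. ent (r x))"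
proof (rule integrable_unit_leb_bounded[of _ 1])
  show "(\<lambda>x. ent (r x)) \<in> borel_measurable unit_leb"
    using profile_measurable[OF assms] by measurable
  show "\<bar>ent (r x)\<bar> \<le> 1" if "x \<in> {0..1}" for x
    using profile_bounds[OF assms that] ent_nonpos[of "r x"] ent_ge[of "r x"] by auto
qed

section \<open>Auxiliary functions and real-valued formulas for the functionals\<close>

locale boundary_data =
  fixes \<rho>0 \<rho>1 :: real
  assumes pos: "0 < \<rho>0" and less: "\<rho>0 < \<rho>1" and less1: "\<rho>1 < 1"
begin

abbreviation "\<phi>0 \<equiv> bdry_phi \<rho>0"
abbreviation "\<phi>1 \<equiv> bdry_phi \<rho>1"
abbreviation "mass \<equiv> \<phi>1 - \<phi>0"

lemma mass_pos: "0 < mass"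
proof -
  have "\<rho>0 / (1 - \<rho>0) < \<rho>1 / (1 - \<rho>1)"
    using pos less less1 by (simp add: field_simps)
  moreover have "0 < \<rho>0 / (1 - \<rho>0)" using pos less less1 by simp
  ultimately show ?thesis unfolding bdry_phi_def by (simp add: ln_less_cancel_iff)
qed

definition F_regular :: "(real \<Rightarrow> real) \<Rightarrow> bool" where
  "F_regular \<phi> \<longleftrightarrow> \<phi> \<in> borel_measurable unit_leb \<and> (\<forall>x\<in>{0..1}. \<phi>0 \<le> \<phi> x \<and> \<phi> x \<le> \<phi>1)"

lemma F_set_obtain:
  assumes "\<phi> \<in> F_set \<rho>0 \<rho>1"
  obtains \<mu> where "sets \<mu> = sets unit_leb" "finite_measure \<mu>" "is_differential \<rho>0 \<phi> \<mu>"
    "\<And>x. x \<in> {0..1} \<Longrightarrow> \<phi> x = \<phi>0 + measure \<mu> {0..x}" "measure \<mu> {0..1} = mass"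
  using assms unfolding F_set_def is_differential_def sets_unit_leb by auto

lemma F_set_mono:
  assumes "\<phi> \<in> F_set \<rho>0 \<rho>1"
  shows "mono_on {0..1} \<phi>" "\<And>x. x \<in> {0..1} \<Longrightarrow> \<phi>0 \<le> \<phi> x \<and> \<phi> x \<le> \<phi>1"
proof -
  from assms obtain \<mu> where \<mu>: "sets \<mu> = sets unit_leb" "finite_measure \<mu>"
    "\<And>x. x \<in> {0..1} \<Longrightarrow> \<phi> x = \<phi>0 + measure \<mu> {0..x}" "measure \<mu> {0..1} = mass"
    by (rule F_set_obtain) (rule that)
  have le: "\<phi> x \<le> \<phi> y" if "x \<in> {0..1}" "y \<in> {0..1}" "x \<le> y" for x y
  proof -
    have "measure \<mu> {0..x} \<le> measure \<mu> {0..y}"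
      by (rule finite_measure.finite_measure_mono[OF \<mu>(2)])
        (use that in \<open>auto simp: \<mu>(1) intro!: in_sets_unit_leb\<close>)
    then show ?thesis using that by (simp add: \<mu>(3))
  qed
  then show "mono_on {0..1} \<phi>" by (auto simp: mono_on_def)
  show "\<phi>0 \<le> \<phi> x \<and> \<phi> x \<le> \<phi>1" if "x \<in> {0..1}" for x
    using le[of x 1] that \<mu>(3)[of x] \<mu>(3)[of 1] \<mu>(4) by auto
qed

lemma F_set_regular: "\<phi> \<in> F_set \<rho>0 \<rho>1 \<Longrightarrow> F_regular \<phi>"
  unfolding F_regular_def
  using F_set_mono borel_measurable_mono_on_fnc measurable_cong_sets[OF sets_unit_leb refl] by blast

lemma F_regular_abs_le: "F_regular \<phi> \<Longrightarrow> x \<in> {0..1} \<Longrightarrow> \<bar>\<phi> x\<bar> \<le> \<bar>\<phi>0\<bar> + \<bar>\<phi>1\<bar>"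
  unfolding F_regular_def by (smt (verit, best))

lemma F_regular_integrable: "F_regular \<phi> \<Longrightarrow> integrable unit_leb \<phi>"
  using F_regular_abs_le by (intro integrable_unit_leb_bounded) (auto simp: F_regular_def)

lemma integrable_coupling:
  assumes "profile r" "F_regular \<phi>"
  shows "integrable unit_leb (\<lambda>x. (1 - r x) * \<phi> x - ln (1 + exp (\<phi> x)))"
proof (rule integrable_unit_leb_bounded[of _ "\<bar>\<phi>0\<bar> + \<bar>\<phi>1\<bar> + ln (1 + exp \<phi>1)"])
  have [measurable]: "r \<in> borel_measurable unit_leb" "\<phi> \<in> borel_measurable unit_leb"
    using assms by (auto simp: profile_def F_regular_def)
  show "(\<lambda>x. (1 - r x) * \<phi> x - ln (1 + exp (\<phi> x))) \<in> borel_measurable unit_leb"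
    by measurable
  fix x :: real assume x: "x \<in> {0..1}"
  have *: "\<bar>p - q\<bar> \<le> a + b" if "\<bar>p\<bar> \<le> a" "0 \<le> q" "q \<le> b" for p q a b :: real
    using that by linarith
  have "\<bar>(1 - r x) * \<phi> x\<bar> \<le> 1 * (\<bar>\<phi>0\<bar> + \<bar>\<phi>1\<bar>)"
    unfolding abs_mult
    using profile_bounds[OF assms(1) x] F_regular_abs_le[OF assms(2) x] by (intro mult_mono) auto
  moreover have "0 \<le> ln (1 + exp (\<phi> x))" by simp
  moreover have "ln (1 + exp (\<phi> x)) \<le> ln (1 + exp \<phi>1)"
    using assms(2) x by (subst ln_le_cancel_iff) (auto simp: F_regular_def add_pos_pos)
  ultimately show "\<bar>(1 - r x) * \<phi> x - ln (1 + exp (\<phi> x))\<bar> \<le> \<bar>\<phi>0\<bar> + \<bar>\<phi>1\<bar> + ln (1 + exp \<phi>1)"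
    by (intro *) auto
qed

lemma G_inv_eq:
  assumes "profile r" "\<phi> \<in> F_set \<rho>0 \<rho>1"
  shows "G_inv (abs_linf r) \<phi> = ereal (Ent r + coupling r \<phi>)"
proof -
  note i = integrable_ent[OF assms(1)] integrable_coupling[OF assms(1) F_set_regular[OF assms(2)]]
  have "G_inv (abs_linf r) \<phi> =
      ereal (LINT x|unit_leb. ent (r x) + ((1 - r x) * \<phi> x - ln (1 + exp (\<phi> x))))"
    unfolding G_inv.abs_eq[OF profile_linf_rel[OF assms(1)]]
    by (rule ext_integral_ereal) (use i profile_bounds[OF assms(1)] in \<open>auto simp: s_ent_eq\<close>)
  also have "\<dots> = ereal (Ent r + coupling r \<phi>)"
    unfolding Ent_def coupling_def using i by simp
  finally show ?thesis .
qed

text \<open>g is a version of the density of d\<phi> that is bounded at every point. Radon-Nikodym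
  derivatives then occur only in the two lemmas that translate to and from
  \<open>G_visc\<close>.\<close>

definition admissible :: "real \<Rightarrow> (real \<Rightarrow> real) \<Rightarrow> (real \<Rightarrow> real) \<Rightarrow> bool" where
  "admissible \<epsilon> \<phi> g \<longleftrightarrow> g \<in> borel_measurable unit_leb \<and> (\<forall>x\<in>{0..1}. 0 \<le> g x \<and> g x \<le> 1 / \<epsilon>) \<and>
     (\<forall>x\<in>{0..1}. \<phi> x = \<phi>0 + (LINT y|unit_leb. indicator {0..x} y * g y)) \<and>
     (LINT y|unit_leb. g y) = mass"

lemma admissible_differential:
  assumes "admissible \<epsilon> \<phi> g"
  shows "is_differential \<rho>0 \<phi> (density unit_leb (\<lambda>x. ennreal (g x)))"
    and "measure (density unit_leb (\<lambda>x. ennreal (g x))) {0..1} = mass"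
    and "\<phi> \<in> F_set \<rho>0 \<rho>1"
    and "finite_measure (density unit_leb (\<lambda>x. ennreal (g x)))"
proof -
  let ?D = "density unit_leb (\<lambda>x. ennreal (g x))"
  have g: "g \<in> borel_measurable unit_leb" "\<And>x. x \<in> {0..1} \<Longrightarrow> 0 \<le> g x \<and> g x \<le> 1 / \<epsilon>"
    using assms by (auto simp: admissible_def)
  have em: "emeasure ?D {0..x} = ennreal (LINT y|unit_leb. indicator {0..x} y * g y)" if "x \<in> {0..1}" for x
    by (rule emeasure_density_unit_leb[OF g]) (use that in \<open>auto intro!: in_sets_unit_leb\<close>)
  have nn: "0 \<le> (LINT y|unit_leb. indicator {0..x} y * g y)" for x
    by (rule integral_nonneg_AE) (use g in \<open>auto intro!: AE_I2 split: split_indicator\<close>)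
  have m: "measure ?D {0..x} = (LINT y|unit_leb. indicator {0..x} y * g y)" if "x \<in> {0..1}" for x
    using em[OF that] nn[of x] by (simp add: measure_def)
  have one: "(LINT y|unit_leb. indicator {0..1} y * g y) = (LINT y|unit_leb. g y)"
    by (intro Bochner_Integration.integral_cong) auto
  show fin: "finite_measure ?D"
    by (rule finite_measureI) (use em[of 1] in simp)
  show d: "is_differential \<rho>0 \<phi> ?D"
    unfolding is_differential_def using fin assms m by (auto simp: sets_unit_leb admissible_def)
  show mm: "measure ?D {0..1} = mass"
    using m[of 1] one assms by (simp add: admissible_def)
  show "\<phi> \<in> F_set \<rho>0 \<rho>1"
    using d mm by (auto simp: F_set_def)
qed

lemma integrable_ent_density:
  assumes "admissible \<epsilon> \<phi> g" "0 < \<epsilon>"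
  shows "integrable unit_leb (\<lambda>x. ent (\<epsilon> * g x))"
  by (rule integrable_ent)
    (use assms in \<open>auto simp: profile_def admissible_def field_simps\<close>)

lemma G_visc_eq:
  assumes r: "profile r" and adm: "admissible \<epsilon> \<phi> g" and \<epsilon>: "0 < \<epsilon>"
  shows "G_visc \<rho>0 \<epsilon> (abs_linf r) \<phi> = ereal (Ent r + (LINT x|unit_leb. ent (\<epsilon> * g x)) + coupling r \<phi>)"
proof -
  let ?D = "density unit_leb (\<lambda>x. ennreal (g x))"
  have g [measurable]: "g \<in> borel_measurable unit_leb" and gb: "\<And>x. x \<in> {0..1} \<Longrightarrow> 0 \<le> g x \<and> g x \<le> 1 / \<epsilon>"
    using adm by (auto simp: admissible_def)
  note dif = admissible_differential[OF adm]
  note i = integrable_ent[OF r] integrable_coupling[OF r F_set_regular[OF dif(3)]] integrable_ent_density[OF adm \<epsilon>]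
  have D: "differential \<rho>0 \<phi> = ?D"
    by (rule differential_eq[OF dif(1)])
  have ac: "absolutely_continuous unit_leb ?D"
    by (rule absolutely_continuousI_density) simp
  have ae: "AE x in unit_leb. ennreal (g x) = RN_deriv unit_leb ?D x"
    by (rule unit_leb.RN_deriv_unique) auto
  have ae': "AE x in unit_leb. phi_x \<rho>0 \<phi> x = g x"
    using ae AE_space by eventually_elim (unfold phi_x_def D, metis gb enn2real_ennreal space_unit_leb)
  have bd: "AE x in unit_leb. RN_deriv unit_leb ?D x \<le> ennreal (1 / \<epsilon>)"
    using ae AE_space by eventually_elim (metis gb ennreal_leI space_unit_leb)
  have "G_visc \<rho>0 \<epsilon> (abs_linf r) \<phi> = ext_integral (\<lambda>x. s_ent (r x) + s_ent (\<epsilon> * phi_x \<rho>0 \<phi> x)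
           + ereal ((1 - r x) * \<phi> x - ln (1 + exp (\<phi> x))))"
    unfolding G_visc.abs_eq[OF profile_linf_rel[OF r]] D using ac bd by simp
  also have "\<dots> = ext_integral (\<lambda>x. s_ent (r x) + s_ent (\<epsilon> * g x)
           + ereal ((1 - r x) * \<phi> x - ln (1 + exp (\<phi> x))))"
    by (rule ext_integral_cong_AE) (use ae' in eventually_elim, simp)
  also have "\<dots> = ereal (LINT x|unit_leb. ent (r x) + ent (\<epsilon> * g x) + ((1 - r x) * \<phi> x - ln (1 + exp (\<phi> x))))"
  proof (rule ext_integral_ereal)
    fix x :: real assume x: "x \<in> {0..1}"
    have "0 \<le> \<epsilon> * g x" "\<epsilon> * g x \<le> 1" using gb[OF x] \<epsilon> by (auto simp: field_simps)
    then show "s_ent (r x) + s_ent (\<epsilon> * g x) + ereal ((1 - r x) * \<phi> x - ln (1 + exp (\<phi> x)))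
      = ereal (ent (r x) + ent (\<epsilon> * g x) + ((1 - r x) * \<phi> x - ln (1 + exp (\<phi> x))))"
      using profile_bounds[OF r x] by (simp add: s_ent_eq)
  qed (use i in auto)
  also have "\<dots> = ereal (Ent r + (LINT x|unit_leb. ent (\<epsilon> * g x)) + coupling r \<phi>)"
    unfolding Ent_def coupling_def using i by simp
  finally show ?thesis .
qed

lemma G_visc_finite_admissible:
  assumes \<phi>: "\<phi> \<in> F_set \<rho>0 \<rho>1" and r: "profile r" and \<epsilon>: "0 < \<epsilon>"
    and fin: "G_visc \<rho>0 \<epsilon> (abs_linf r) \<phi> \<noteq> \<infinity>"
  obtains g where "admissible \<epsilon> \<phi> g"
proof -
  from \<phi> obtain \<mu> where \<mu>: "sets \<mu> = sets unit_leb" "finite_measure \<mu>" "is_differential \<rho>0 \<phi> \<mu>"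
    "\<And>x. x \<in> {0..1} \<Longrightarrow> \<phi> x = \<phi>0 + measure \<mu> {0..x}" "measure \<mu> {0..1} = mass"
    by (rule F_set_obtain) (rule that)
  have D: "differential \<rho>0 \<phi> = \<mu>"
    by (rule differential_eq[OF \<mu>(3)])
  have ac: "absolutely_continuous unit_leb \<mu>"
    and bd: "AE x in unit_leb. RN_deriv unit_leb \<mu> x \<le> ennreal (1 / \<epsilon>)"
    using fin unfolding G_visc.abs_eq[OF profile_linf_rel[OF r]] D by (auto split: if_splits)
  \<comment> \<open>Truncation at 1 / \<epsilon> alters the density only on a null set and makes the
    bound hold everywhere; infinite values, which \<open>enn2real\<close> sends to 0, lie in a null
    set as well.\<close>
  define g where "g x = min (enn2real (RN_deriv unit_leb \<mu> x)) (1 / \<epsilon>)" for x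
  have g: "g \<in> borel_measurable unit_leb" "\<And>x. x \<in> {0..1} \<Longrightarrow> 0 \<le> g x \<and> g x \<le> 1 / \<epsilon>"
    unfolding g_def using \<epsilon> by auto
  have ae: "AE x in unit_leb. RN_deriv unit_leb \<mu> x = ennreal (g x)"
    using bd
  proof eventually_elim
    fix x assume *: "RN_deriv unit_leb \<mu> x \<le> ennreal (1 / \<epsilon>)"
    then have "RN_deriv unit_leb \<mu> x \<noteq> top" by (auto simp: top_unique)
    moreover have "enn2real (RN_deriv unit_leb \<mu> x) \<le> 1 / \<epsilon>"
      using * \<epsilon> by (intro enn2real_leI) auto
    ultimately show "RN_deriv unit_leb \<mu> x = ennreal (g x)"
      by (simp add: g_def ennreal_enn2real less_top)
  qed
  have "\<mu> = density unit_leb (RN_deriv unit_leb \<mu>)"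
    using unit_leb.density_RN_deriv[OF ac \<mu>(1)] by simp
  also have "\<dots> = density unit_leb (\<lambda>x. ennreal (g x))"
    by (rule density_cong) (use ae g in auto)
  finally have \<mu>_eq: "\<mu> = density unit_leb (\<lambda>x. ennreal (g x))" .
  have nn: "0 \<le> (LINT y|unit_leb. indicator {0..x} y * g y)" for x
    by (rule integral_nonneg_AE) (use g in \<open>auto intro!: AE_I2 split: split_indicator\<close>)
  have em: "emeasure \<mu> {0..x} = ennreal (LINT y|unit_leb. indicator {0..x} y * g y)" if "x \<in> {0..1}" for x
    unfolding \<mu>_eq by (rule emeasure_density_unit_leb[OF g]) (use that in \<open>auto intro!: in_sets_unit_leb\<close>)
  have m: "measure \<mu> {0..x} = (LINT y|unit_leb. indicator {0..x} y * g y)" if "x \<in> {0..1}" for x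
    using em[OF that] nn[of x] by (simp add: measure_def)
  have one: "(LINT y|unit_leb. indicator {0..1} y * g y) = (LINT y|unit_leb. g y)"
    by (intro Bochner_Integration.integral_cong) auto
  have "admissible \<epsilon> \<phi> g"
    unfolding admissible_def using g \<mu>(4,5) m one m[of 1] by auto
  then show thesis by (rule that)
qed

lemma So_inv_le: "profile r \<Longrightarrow> \<phi> \<in> F_set \<rho>0 \<rho>1 \<Longrightarrow> So_inv \<rho>0 \<rho>1 (abs_linf r) \<le> ereal (Ent r + coupling r \<phi>)"
  unfolding So_inv_def by (metis G_inv_eq INF_lower)

lemma So_inv_ge:
  assumes "profile r" "\<And>\<phi>. \<phi> \<in> F_set \<rho>0 \<rho>1 \<Longrightarrow> c \<le> ereal (Ent r + coupling r \<phi>)"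
  shows "c \<le> So_inv \<rho>0 \<rho>1 (abs_linf r)"
  unfolding So_inv_def using assms by (auto intro!: INF_greatest simp: G_inv_eq)

lemma So_visc_le:
  assumes "profile r" "admissible \<epsilon> \<phi> g" "0 < \<epsilon>"
  shows "So_visc \<rho>0 \<rho>1 \<epsilon> (abs_linf r) \<le> ereal (Ent r + (LINT x|unit_leb. ent (\<epsilon> * g x)) + coupling r \<phi>)"
  unfolding So_visc_def using admissible_differential(3)[OF assms(2)] G_visc_eq[OF assms]
  by (metis INF_lower)

lemma So_visc_ge:
  assumes "profile r" "0 < \<epsilon>"
    and "\<And>\<phi> g. admissible \<epsilon> \<phi> g \<Longrightarrow> c \<le> ereal (Ent r + (LINT x|unit_leb. ent (\<epsilon> * g x)) + coupling r \<phi>)"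
  shows "c \<le> So_visc \<rho>0 \<rho>1 \<epsilon> (abs_linf r)"
  unfolding So_visc_def
proof (rule INF_greatest)
  fix \<phi> assume \<phi>: "\<phi> \<in> F_set \<rho>0 \<rho>1"
  show "c \<le> G_visc \<rho>0 \<epsilon> (abs_linf r) \<phi>"
  proof (cases "G_visc \<rho>0 \<epsilon> (abs_linf r) \<phi> = \<infinity>")
    case False
    with G_visc_finite_admissible[OF \<phi> assms(1,2)] obtain g where g: "admissible \<epsilon> \<phi> g" by blast
    show ?thesis using assms(3)[OF g] G_visc_eq[OF assms(1) g assms(2)] by simp
  qed simp
qed

end

section \<open>Comparison of the two functionals\<close>

lemma integral_unit_leb_initial:
  fixes g :: "real \<Rightarrow> real"
  assumes g: "g \<in> borel_measurable unit_leb" "\<And>x. x \<in> {0..1} \<Longrightarrow> 0 \<le> g x \<and> g x \<le> B"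
    and x: "x \<in> {0..1}" and I: "(g has_integral I) {0..x}"
  shows "(LINT y|unit_leb. indicator {0..x} y * g y) = I"
proof -
  have [measurable]: "g \<in> borel_measurable unit_leb" "{0..x} \<in> sets unit_leb"
    using g(1) x by (auto intro!: in_sets_unit_leb)
  have "integrable unit_leb (\<lambda>y. indicator {0..x} y * g y)"
  proof (rule integrable_unit_leb_bounded[of _ B])
    show "\<bar>indicator {0..x} y * g y\<bar> \<le> B" if "y \<in> {0..1}" for y
      using g(2)[OF that] by (auto split: split_indicator)
  qed measurable
  then have "integrable lborel (\<lambda>y. indicator {0..1} y *\<^sub>R (indicator {0..x} y * g y))"
    unfolding unit_leb_def by (subst (asm) integrable_restrict_space) auto
  also have "(\<lambda>y. indicator {0..1} y *\<^sub>R (indicator {0..x} y * g y)) = (\<lambda>y. indicator {0..x} y *\<^sub>R g y)"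
    using x by (auto split: split_indicator)
  finally have i: "set_integrable lborel {0..x} g" unfolding set_integrable_def .
  have "(LINT y|unit_leb. indicator {0..x} y * g y) = (LINT y:{0..x}|lborel. g y)"
    unfolding integral_unit_leb set_lebesgue_integral_def
    using x by (intro Bochner_Integration.integral_cong) (auto split: split_indicator)
  also have "\<dots> = integral {0..x} g"
    by (rule set_borel_integral_eq_integral(2)[OF i])
  finally show ?thesis using I by (simp add: integral_unique)
qed

lemma ln_1_exp_lipschitz: "\<bar>ln (1 + exp a) - ln (1 + exp b)\<bar> \<le> \<bar>a - b\<bar>" for a b :: real
proof -
  have *: "ln (1 + exp a) \<le> (a - b) + ln (1 + exp b) \<and> ln (1 + exp b) \<le> ln (1 + exp a)"
    if "b \<le> a" for a b :: real
  proof
    have "1 + exp a \<le> exp (a - b) * (1 + exp b)"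
      using that by (simp add: distrib_left exp_diff)
    then have "ln (1 + exp a) \<le> ln (exp (a - b) * (1 + exp b))"
      by (subst ln_le_cancel_iff) (auto simp: add_pos_pos)
    then show "ln (1 + exp a) \<le> (a - b) + ln (1 + exp b)"
      by (subst (asm) ln_mult) (auto simp: add_pos_pos less_imp_neq[symmetric])
    show "ln (1 + exp b) \<le> ln (1 + exp a)"
      using that by (subst ln_le_cancel_iff) (auto simp: add_pos_pos)
  qed
  show ?thesis using *[of a b] *[of b a] by linarith
qed

text \<open>Minimization over the density a: Gibbs' inequality with the logistic density q = e^t /
  (1 + e^t). The left side is ln (q (1 - q)), the logarithm of the flux at q.\<close>

lemma ent_dual:
  assumes "0 \<le> a" "a \<le> 1"
  shows "t - 2 * ln (1 + exp t) \<le> ent a + (1 - a) * t - ln (1 + exp t)"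
proof -
  define q where "q = exp t / (1 + exp t)"
  have p: "0 < 1 + exp t" by (simp add: add_pos_pos)
  have q: "0 < q" "q < 1" "1 - q = 1 / (1 + exp t)"
    using p by (auto simp: q_def field_simps)
  have lq: "ln q = t - ln (1 + exp t)"
    using p by (simp add: q_def ln_div)
  have lq': "ln (1 - q) = - ln (1 + exp t)"
    unfolding q(3) using p by (simp add: ln_div)
  show ?thesis using gibbs[OF assms q(1,2)] unfolding lq lq' by (simp add: algebra_simps)
qed

lemma ln_1_exp_bdry_phi:
  assumes "0 < a" "a < 1"
  shows "ln (1 + exp (bdry_phi a)) = - ln (1 - a)"
proof -
  have "1 + exp (bdry_phi a) = 1 / (1 - a)"
    using assms by (simp add: bdry_phi_def field_simps)
  then show ?thesis using assms by (simp add: ln_div)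
qed

lemma bdry_phi_eq: "0 < a \<Longrightarrow> a < 1 \<Longrightarrow> bdry_phi a = ln a - ln (1 - a)"
  by (simp add: bdry_phi_def ln_div)

lemma ln_flux: "0 < a \<Longrightarrow> a < 1 \<Longrightarrow> ln (flux a) = ln a + ln (1 - a)"
  by (simp add: flux_def ln_mult)

text \<open>Equality case of \<open>ent_dual\<close>: a is the logistic density belonging to t =
  \<open>bdry_phi a\<close>.\<close>

lemma ent_dual_eq:
  assumes "0 < a" "a < 1"
  shows "ent a + ((1 - a) * bdry_phi a - ln (1 + exp (bdry_phi a))) = ln (flux a)"
  unfolding ln_1_exp_bdry_phi[OF assms] ln_flux[OF assms]
  unfolding bdry_phi_eq[OF assms] ent_def by (simp add: algebra_simps)

section \<open>The minimal flux and the inviscid minimum\<close>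

context boundary_data
begin

definition flux_min :: real where
  "flux_min = min (flux \<rho>0) (flux \<rho>1)"

lemma flux_min_pos: "0 < flux_min"
  using pos less less1 by (simp add: flux_min_def flux_def)

text \<open>The flux is concave, so its minimum over an interval sits at an endpoint; the sign of 1
  - (\<rho>0 + a) tells which endpoint to compare with.\<close>

lemma flux_min_le:
  assumes "\<rho>0 \<le> a" "a \<le> \<rho>1"
  shows "flux_min \<le> flux a"
proof (cases "\<rho>0 + a \<le> 1")
  case True
  have "flux a - flux \<rho>0 = (a - \<rho>0) * (1 - (\<rho>0 + a))" by (simp add: flux_def algebra_simps)
  also have "\<dots> \<ge> 0" using assms True by (intro mult_nonneg_nonneg) auto
  finally show ?thesis by (simp add: flux_min_def)
next
  case False
  have "flux a - flux \<rho>1 = (\<rho>1 - a) * ((\<rho>1 + a) - 1)" by (simp add: flux_def algebra_simps)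
  also have "\<dots> \<ge> 0" using assms False less by (intro mult_nonneg_nonneg) auto
  finally show ?thesis by (simp add: flux_min_def)
qed

lemma logistic_range:
  assumes "\<phi>0 \<le> t" "t \<le> \<phi>1"
  obtains a where "\<rho>0 \<le> a" "a \<le> \<rho>1" "t = bdry_phi a"
proof -
  define a where "a = exp t / (1 + exp t)"
  have p: "0 < 1 + exp t" by (simp add: add_pos_pos)
  have a: "1 - a = 1 / (1 + exp t)" using p by (simp add: a_def field_simps)
  then have "a / (1 - a) = exp t" using p by (simp add: a_def)
  then have t: "bdry_phi a = t" by (simp add: bdry_phi_def)
  have e: "exp \<phi>0 = \<rho>0 / (1 - \<rho>0)" "exp \<phi>1 = \<rho>1 / (1 - \<rho>1)"
    using pos less less1 by (auto simp: bdry_phi_def)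
  have "\<rho>0 / (1 - \<rho>0) \<le> exp t" "exp t \<le> \<rho>1 / (1 - \<rho>1)"
    unfolding e[symmetric] using assms by auto
  then have "\<rho>0 \<le> a" "a \<le> \<rho>1"
    using p pos less less1 by (auto simp: a_def field_simps)
  with t that show thesis by blast
qed

lemma ln_flux_logistic:
  assumes "0 < a" "a < 1"
  shows "bdry_phi a - 2 * ln (1 + exp (bdry_phi a)) = ln (flux a)"
  unfolding ln_1_exp_bdry_phi[OF assms] ln_flux[OF assms]
  unfolding bdry_phi_eq[OF assms] by simp

lemma ln_flux_min_le:
  assumes "\<phi>0 \<le> t" "t \<le> \<phi>1"
  shows "ln flux_min \<le> t - 2 * ln (1 + exp t)"
proof -
  from assms obtain a where a: "\<rho>0 \<le> a" "a \<le> \<rho>1" "t = bdry_phi a" by (rule logistic_range)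
  have "ln flux_min \<le> ln (flux a)"
    using flux_min_le[OF a(1,2)] flux_min_pos by (subst ln_le_cancel_iff) auto
  then show ?thesis using a pos less1 ln_flux_logistic[of a] by simp
qed

text \<open>Pointwise minimization first in r and then in \<phi>. This loses nothing for the overall
  minimum, because the minimal flux belongs to an endpoint of the range and a step function can stay
  there almost everywhere.\<close>

lemma Ent_coupling_ge:
  assumes "profile r" "F_regular \<phi>"
  shows "ln flux_min \<le> Ent r + coupling r \<phi>"
proof -
  note i = integrable_ent[OF assms(1)] integrable_coupling[OF assms]
  have "ln flux_min = (LINT x|unit_leb. ln flux_min)" by (simp add: unit_leb.prob_space[simplified])
  also have "\<dots> \<le> (LINT x|unit_leb. ent (r x) + ((1 - r x) * \<phi> x - ln (1 + exp (\<phi> x))))"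
  proof (rule integral_mono)
    fix x assume "x \<in> space unit_leb"
    then have x: "x \<in> {0..1}" by simp
    have "ln flux_min \<le> \<phi> x - 2 * ln (1 + exp (\<phi> x))"
      using assms(2) x by (intro ln_flux_min_le) (auto simp: F_regular_def)
    also have "\<dots> \<le> ent (r x) + (1 - r x) * \<phi> x - ln (1 + exp (\<phi> x))"
      using profile_bounds[OF assms(1) x] by (intro ent_dual) auto
    finally show "ln flux_min \<le> ent (r x) + ((1 - r x) * \<phi> x - ln (1 + exp (\<phi> x)))" by simp
  qed (use i in auto)
  also have "\<dots> = Ent r + coupling r \<phi>" unfolding Ent_def coupling_def using i by simp
  finally show ?thesis .
qed

text \<open>For \<alpha> = 0 the atom sits at the left endpoint and the function is \<phi>1 on all
  of [0,1]; for \<alpha> = 1 it is \<phi>0 except at the point 1.\<close>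

definition step_phi :: "real \<Rightarrow> real \<Rightarrow> real" where
  "step_phi \<alpha> x = \<phi>0 + mass * indicator {\<alpha>..} x"

lemma step_phi_F_set:
  assumes "\<alpha> \<in> {0..1}"
  shows "step_phi \<alpha> \<in> F_set \<rho>0 \<rho>1"
proof -
  let ?B = "restrict_space borel {0..1::real}"
  \<comment> \<open>The point mass at \<alpha>, written as a constant density over the Dirac
    measure.\<close>
  let ?\<mu> = "density (return ?B \<alpha>) (\<lambda>_. ennreal mass)"
  have em: "emeasure ?\<mu> A = ennreal mass * indicator A \<alpha>" if "A \<in> sets ?B" for A
    using that by (subst emeasure_density) (auto simp: nn_integral_cmult)
  have meas: "measure ?\<mu> A = mass * indicator A \<alpha>" if "A \<in> sets ?B" for A
    using em[OF that] mass_pos by (auto simp: measure_def split: split_indicator)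
  have sets: "{0..x} \<in> sets ?B" if "x \<in> {0..1}" for x :: real
    using that by (auto simp: sets_restrict_space intro!: image_eqI[of _ _ "{0..x}"])
  have sp: "space ?\<mu> = {0..1}" by (simp add: space_restrict_space)
  have "finite_measure ?\<mu>"
    by (rule finite_measureI) (use em[OF sets[of 1]] assms in \<open>simp add: sp\<close>)
  moreover have "step_phi \<alpha> x = \<phi>0 + measure ?\<mu> {0..x}" if "x \<in> {0..1}" for x
    using meas[OF sets[OF that]] assms that by (simp add: step_phi_def indicator_def)
  ultimately show ?thesis
    using meas[OF sets[of 1]] assms
    unfolding F_set_def is_differential_def mem_Collect_eq
    by (intro exI[of _ ?\<mu>]) (auto simp: indicator_def)
qed

lemma So_inv_real:
  assumes "profile r"
  obtains s where "So_inv \<rho>0 \<rho>1 (abs_linf r) = ereal s" "ln flux_min \<le> s"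
proof -
  have "ereal (ln flux_min) \<le> So_inv \<rho>0 \<rho>1 (abs_linf r)"
    by (rule So_inv_ge[OF assms]) (use Ent_coupling_ge[OF assms] F_set_regular in simp)
  moreover have "So_inv \<rho>0 \<rho>1 (abs_linf r) \<le> ereal (Ent r + coupling r (step_phi 0))"
    by (rule So_inv_le[OF assms step_phi_F_set]) simp
  ultimately show thesis
    using that by (cases "So_inv \<rho>0 \<rho>1 (abs_linf r)") auto
qed

definition step_rho :: "real \<Rightarrow> real \<Rightarrow> real" where
  "step_rho \<alpha> x = \<rho>0 * indicator {0..<\<alpha>} x + \<rho>1 * indicator {\<alpha>..1} x"

lemma profile_step_rho: "profile (step_rho \<alpha>)"
  unfolding profile_def step_rho_def
  using pos less less1 by (auto intro!: borel_measurable_unit_leb split: split_indicator)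

text \<open>Pairing the step profile with the step function at the same \<alpha> gives equality in
  \<open>ent_dual\<close>, so the lower bound is attained. The flux assumption unifies the three
  cases: \<alpha> = 1, \<alpha> = 0, or any \<alpha> when the boundary fluxes agree.\<close>

lemma So_inv_step_rho:
  assumes \<alpha>: "\<alpha> \<in> {0..1}" and ae: "AE x in unit_leb. flux (step_rho \<alpha> x) = flux_min"
  shows "So_inv \<rho>0 \<rho>1 (abs_linf (step_rho \<alpha>)) = ereal (ln flux_min)"
proof -
  let ?r = "step_rho \<alpha>" and ?\<phi> = "step_phi \<alpha>"
  note F = step_phi_F_set[OF \<alpha>]
  note i = integrable_ent[OF profile_step_rho] integrable_coupling[OF profile_step_rho F_set_regular[OF F]]
  have "Ent ?r + coupling ?r ?\<phi> = (LINT x|unit_leb. ent (?r x) + ((1 - ?r x) * ?\<phi> x - ln (1 + exp (?\<phi> x))))"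
    unfolding Ent_def coupling_def using i by simp
  also have "\<dots> = (LINT x|unit_leb. ln flux_min)"
  proof (rule integral_cong_AE)
    show "AE x in unit_leb. ent (?r x) + ((1 - ?r x) * ?\<phi> x - ln (1 + exp (?\<phi> x))) = ln flux_min"
      using ae AE_space
    proof eventually_elim
      fix x assume x: "flux (?r x) = flux_min" "x \<in> space unit_leb"
      have 1: "?\<phi> x = bdry_phi (?r x)" "0 < ?r x" "?r x < 1"
        using x(2) pos less less1 by (auto simp: step_phi_def step_rho_def split: split_indicator)
      show "ent (?r x) + ((1 - ?r x) * ?\<phi> x - ln (1 + exp (?\<phi> x))) = ln flux_min"
        unfolding 1(1) ent_dual_eq[OF 1(2,3)] x(1) ..
    qed
  qed (use i in auto)
  also have "\<dots> = ln flux_min" by (simp add: unit_leb.prob_space[simplified])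
  finally have "So_inv \<rho>0 \<rho>1 (abs_linf ?r) \<le> ereal (ln flux_min)"
    using So_inv_le[OF profile_step_rho F] by metis
  moreover obtain s where "So_inv \<rho>0 \<rho>1 (abs_linf ?r) = ereal s" "ln flux_min \<le> s"
    using So_inv_real[OF profile_step_rho] .
  ultimately show ?thesis by simp
qed

lemma stationary_inv_value:
  assumes "\<rho>bar \<in> stationary_inv \<rho>0 \<rho>1"
  obtains r where "profile r" "\<rho>bar = abs_linf r" "So_inv \<rho>0 \<rho>1 \<rho>bar = ereal (ln flux_min)"
proof -
  \<comment> \<open>The sign of 1 - (\<rho>0 + \<rho>1) decides which boundary density has the
    smaller flux.\<close>
  have fl: "flux \<rho>1 - flux \<rho>0 = (\<rho>1 - \<rho>0) * (1 - (\<rho>0 + \<rho>1))" by (simp add: flux_def algebra_simps)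
  have ne: "AE x in unit_leb. x \<noteq> (1::real)"
    unfolding unit_leb_def using AE_lborel_singleton[of "1::real"] by (subst AE_restrict_space_iff) auto
  have same: "abs_linf f = abs_linf g" if "AE x in unit_leb. g x = f x" "ess_bounded f" "profile g" for f g
  proof -
    have "linf_rel f g" using that profile_ess_bounded by (auto simp: linf_rel_def elim: eventually_mono)
    then show ?thesis by (metis Quotient_linf Quotient_rel_abs)
  qed
  have const: "ess_bounded (\<lambda>_. c)" for c by (auto simp: ess_bounded_def)
  have "\<exists>\<alpha>\<in>{0..1}. \<rho>bar = abs_linf (step_rho \<alpha>) \<and> (AE x in unit_leb. flux (step_rho \<alpha> x) = flux_min)"
  proof (cases "\<rho>0 + \<rho>1" "1 :: real" rule: linorder_cases)
    case less
    then have "0 < flux \<rho>1 - flux \<rho>0" unfolding fl using boundary_data_axioms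
      by (intro mult_pos_pos) (auto simp: boundary_data_def)
    then have "flux_min = flux \<rho>0" by (simp add: flux_min_def)
    \<comment> \<open>\<open>step_rho 1\<close> jumps to \<rho>1 at the point 1, so it agrees with
      the constant only almost everywhere.\<close>
    moreover have *: "AE x in unit_leb. step_rho 1 x = \<rho>0"
      using ne AE_space by eventually_elim (auto simp: step_rho_def split: split_indicator)
    moreover have "\<rho>bar = abs_linf (step_rho 1)"
      using assms less same[OF * const profile_step_rho] by (auto simp: stationary_inv_def)
    moreover have "AE x in unit_leb. flux (step_rho 1 x) = flux \<rho>0"
      using * by eventually_elim simp
    ultimately show ?thesis by (intro bexI[of _ 1]) auto
  next
    case greater
    then have "flux \<rho>1 - flux \<rho>0 < 0" unfolding fl using less
      by (intro mult_pos_neg) auto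
    then have "flux_min = flux \<rho>1" by (simp add: flux_min_def)
    moreover have *: "AE x in unit_leb. step_rho 0 x = \<rho>1"
      using AE_space by eventually_elim (auto simp: step_rho_def split: split_indicator)
    moreover have "\<rho>bar = abs_linf (step_rho 0)"
      using assms greater same[OF * const profile_step_rho] by (auto simp: stationary_inv_def)
    moreover have "AE x in unit_leb. flux (step_rho 0 x) = flux \<rho>1"
      using * by eventually_elim simp
    ultimately show ?thesis by (intro bexI[of _ 0]) auto
  next
    case equal
    then obtain \<alpha> where \<alpha>: "\<alpha> \<in> {0..1}" "\<rho>bar = abs_linf (step_rho \<alpha>)"
      using assms by (auto simp: stationary_inv_def step_rho_def[abs_def])
    have eq: "flux \<rho>1 = flux \<rho>0" using fl equal by simp
    have "AE x in unit_leb. flux (step_rho \<alpha> x) = flux_min"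
      using AE_space by eventually_elim (auto simp: eq step_rho_def flux_min_def split: split_indicator)
    with \<alpha> show ?thesis by blast
  qed
  then obtain \<alpha> where \<alpha>: "\<alpha> \<in> {0..1}" "\<rho>bar = abs_linf (step_rho \<alpha>)"
    "AE x in unit_leb. flux (step_rho \<alpha> x) = flux_min" by blast
  show thesis
    using that[OF profile_step_rho \<alpha>(2)] So_inv_step_rho[OF \<alpha>(1,3)] \<alpha>(2) by simp
qed

text \<open>One unit of the factor 2 comes from (1 - r) \<phi> with 0 \<le> 1 - r \<le> 1, the other
  from the 1-Lipschitz function ln (1 + exp t).\<close>

lemma coupling_lipschitz:
  assumes "profile r" "F_regular \<phi>" "F_regular \<psi>"
  shows "coupling r \<phi> - coupling r \<psi> \<le> 2 * (LINT x|unit_leb. \<bar>\<phi> x - \<psi> x\<bar>)"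
proof -
  note i = integrable_coupling[OF assms(1,2)] integrable_coupling[OF assms(1,3)]
    F_regular_integrable[OF assms(2)] F_regular_integrable[OF assms(3)]
  have "coupling r \<phi> - coupling r \<psi> = (LINT x|unit_leb. ((1 - r x) * \<phi> x - ln (1 + exp (\<phi> x))) -
      ((1 - r x) * \<psi> x - ln (1 + exp (\<psi> x))))"
    unfolding coupling_def using i by simp
  also have "\<dots> \<le> (LINT x|unit_leb. 2 * \<bar>\<phi> x - \<psi> x\<bar>)"
  proof (rule integral_mono)
    fix x assume "x \<in> space unit_leb"
    then have r: "0 \<le> r x" "r x \<le> 1" using profile_bounds[OF assms(1)] by auto
    have "(1 - r x) * (\<phi> x - \<psi> x) \<le> (1 - r x) * \<bar>\<phi> x - \<psi> x\<bar>"
      using r by (intro mult_left_mono) auto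
    also have "\<dots> \<le> 1 * \<bar>\<phi> x - \<psi> x\<bar>"
      using r by (intro mult_right_mono) auto
    finally have "(1 - r x) * \<phi> x - (1 - r x) * \<psi> x \<le> \<bar>\<phi> x - \<psi> x\<bar>"
      by (simp add: right_diff_distrib)
    moreover have "(p - lp) - (q - lq) \<le> 2 * d" if "p - q \<le> d" "\<bar>lp - lq\<bar> \<le> d" for p q lp lq d :: real
      using that by linarith
    ultimately
    show "((1 - r x) * \<phi> x - ln (1 + exp (\<phi> x))) - ((1 - r x) * \<psi> x - ln (1 + exp (\<psi> x)))
        \<le> 2 * \<bar>\<phi> x - \<psi> x\<bar>" using ln_1_exp_lipschitz by blast
  qed (use i in auto)
  finally show ?thesis by simp
qed

text \<open>Averaging an extension of \<open>\<phi>\<close> over windows of width proportional to \<open>\<epsilon>\<close>. The window at \<open>x\<close>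
  slides from lying entirely to the left of 0 (where the extension is \<open>\<phi>0\<close>) to lying entirely to
  the right of 1 (where it is \<open>\<phi>1\<close>), so that the boundary values are attained exactly.\<close>

lemma mollify:
  assumes \<phi>: "\<phi> \<in> F_set \<rho>0 \<rho>1" and \<epsilon>: "0 < \<epsilon>" "\<epsilon> * mass < 1"
  obtains \<xi> g where "admissible \<epsilon> \<xi> g" "(LINT x|unit_leb. \<bar>\<xi> x - \<phi> x\<bar>) \<le> \<epsilon> * mass\<^sup>2"
proof -
  define \<kappa> where "\<kappa> = \<epsilon> * mass"
  have \<kappa>: "0 < \<kappa>" "\<kappa> < 1" using \<epsilon> mass_pos by (auto simp: \<kappa>_def)
  \<comment> \<open>The window at x is [m x - \<delta>, m x]. With m = 1 + \<delta> it moves from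
    [-\<delta>, 0] to [1, 1 + \<delta>]. The average has slope at most m * mass / \<delta>, which is
    1 / \<epsilon> exactly when \<delta> = m \<kappa>; the two relations determine m and
    \<delta>.\<close>
  define m where "m = 1 / (1 - \<kappa>)"
  define \<delta> where "\<delta> = \<kappa> / (1 - \<kappa>)"
  have m: "0 < m" "m * (1 - \<kappa>) = 1" "m = 1 + \<delta>" "\<delta> = m * \<kappa>" and \<delta>: "0 < \<delta>"
    using \<kappa> by (auto simp: m_def \<delta>_def field_simps)
  define \<psi> where "\<psi> y = (if y < 0 then \<phi>0 else if y > 1 then \<phi>1 else \<phi> y)" for y
  have range: "\<phi>0 \<le> \<psi> y" "\<psi> y \<le> \<phi>1" for y
    using F_set_mono(2)[OF \<phi>, of y] mass_pos by (auto simp: \<psi>_def)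
  have mono: "\<psi> x \<le> \<psi> y" if "x \<le> y" for x y
    using F_set_mono(1)[OF \<phi>] F_set_mono(2)[OF \<phi>, of x] F_set_mono(2)[OF \<phi>, of y] mass_pos that
    unfolding \<psi>_def mono_on_def by auto
  have meas [measurable]: "\<psi> \<in> borel_measurable borel"
    by (rule borel_measurable_mono) (auto intro: monoI mono)
  have int: "\<psi> integrable_on {a..b}" for a b
    by (rule integrable_on_mono_on) (auto simp: mono_on_def intro: mono)
  define \<Psi> where "\<Psi> y = integral {-\<delta>..y} \<psi>" for y
  have \<Psi>: "integral {a..b} \<psi> = \<Psi> b - \<Psi> a" if "-\<delta> \<le> a" "a \<le> b" for a b
    using Henstock_Kurzweil_Integration.integral_combine[OF that int] by (simp add: \<Psi>_def)
  have aff: "((\<lambda>t. \<psi> (m * t + c)) has_integral (\<Psi> (m * x + c) - \<Psi> c) / m) {0..x}"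
    if "-\<delta> \<le> c" "0 \<le> x" for c x
  proof -
    have "c \<le> m * x + c" using m(1) that by simp
    then have "(\<psi> has_integral (\<Psi> (m * x + c) - \<Psi> c)) (cbox c (m * x + c))"
      using integrable_integral[OF int, of c "m * x + c"] \<Psi>[OF that(1)] by simp
    from has_integral_affinity'[OF this m(1), of c] show ?thesis
      using m(1) by (simp add: field_simps)
  qed
  \<comment> \<open>The summands 0 and - \<delta> keep both terms in the form m x + c treated by
    \<open>aff\<close>.\<close>
  define g where "g x = (\<psi> (m * x + 0) - \<psi> (m * x + (- \<delta>))) / \<kappa>" for x
  have g: "g \<in> borel_measurable unit_leb"
    unfolding g_def by (intro borel_measurable_unit_leb) measurable
  have gb: "0 \<le> g x \<and> g x \<le> 1 / \<epsilon>" for x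
  proof
    show "0 \<le> g x" using \<kappa> mono[of "m * x + - \<delta>" "m * x + 0"] \<delta> by (auto simp: g_def)
    have "g x \<le> mass / \<kappa>"
      unfolding g_def using \<kappa> range[of "m * x + 0"] range[of "m * x + - \<delta>"]
      by (intro divide_right_mono) auto
    then show "g x \<le> 1 / \<epsilon>" using mass_pos \<epsilon> by (simp add: \<kappa>_def)
  qed
  have \<Psi>0: "\<Psi> 0 = \<delta> * \<phi>0" 
  proof -
    have "integral {-\<delta>..0} \<psi> = integral {-\<delta>..0} (\<lambda>_. \<phi>0)"
      by (rule integral_spike[of "{0}"]) (auto simp: \<psi>_def)
    then show ?thesis using \<delta> by (simp add: \<Psi>_def)
  qed
  have \<Psi>\<delta>: "\<Psi> (- \<delta>) = 0" by (simp add: \<Psi>_def)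
  have \<Psi>1: "\<Psi> m - \<Psi> 1 = \<delta> * \<phi>1" 
  proof -
    have "integral {1..m} \<psi> = integral {1..m} (\<lambda>_. \<phi>1)"
      by (rule integral_spike[of "{1}"]) (auto simp: \<psi>_def)
    then show ?thesis using \<Psi>[of 1 m] \<delta> m(3) by simp
  qed
  define \<xi> where "\<xi> x = (\<Psi> (m * x) - \<Psi> (m * x - \<delta>)) / \<delta>" for x
  have hi: "(g has_integral \<xi> x - \<phi>0) {0..x}" if "0 \<le> x" for x
  proof -
    have "((\<lambda>t. \<psi> (m * t + 0) - \<psi> (m * t + (- \<delta>))) has_integral
        (\<Psi> (m * x + 0) - \<Psi> 0) / m - (\<Psi> (m * x + (- \<delta>)) - \<Psi> (- \<delta>)) / m) {0..x}"
      using that \<delta> by (intro has_integral_diff aff) auto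
    from has_integral_divide[OF this, of \<kappa>]
    have "(g has_integral ((\<Psi> (m * x + 0) - \<Psi> 0) / m - (\<Psi> (m * x + (- \<delta>)) - \<Psi> (- \<delta>)) / m) / \<kappa>) {0..x}"
      by (simp add: g_def[abs_def])
    also have "((\<Psi> (m * x + 0) - \<Psi> 0) / m - (\<Psi> (m * x + (- \<delta>)) - \<Psi> (- \<delta>)) / m) / \<kappa> = \<xi> x - \<phi>0"
      unfolding \<xi>_def \<Psi>0 \<Psi>\<delta> using m(1) \<kappa> \<delta> by (simp add: m(4) field_simps)
    finally show ?thesis .
  qed
  have L: "(LINT y|unit_leb. indicator {0..x} y * g y) = \<xi> x - \<phi>0" if "x \<in> {0..1}" for x
    using that by (intro integral_unit_leb_initial[OF g gb]) (auto intro!: hi)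
  have \<xi>1: "\<xi> 1 = \<phi>1" using \<delta> \<Psi>1 m(3) by (simp add: \<xi>_def)
  have tot: "(LINT y|unit_leb. g y) = mass"
  proof -
    have "(LINT y|unit_leb. g y) = (LINT y|unit_leb. indicator {0..1} y * g y)"
      by (intro Bochner_Integration.integral_cong) auto
    then show ?thesis using L[of 1] \<xi>1 by simp
  qed
  have adm: "admissible \<epsilon> \<xi> g"
    unfolding admissible_def using g gb L tot by auto
  have close: "\<bar>\<xi> x - \<phi> x\<bar> \<le> \<kappa> * g x" if x: "x \<in> {0..1}" for x
  proof -
    \<comment> \<open>The point x lies in its own window, so \<open>\<xi> x\<close> and
      \<open>\<phi> x\<close> both lie between the values of \<open>\<psi>\<close> at the window's
      ends. Their gap is \<kappa> g, whose integral is \<kappa> * mass.\<close>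
    let ?a = "m * x - \<delta>" and ?b = "m * x"
    have ab: "-\<delta> \<le> ?a" "?a \<le> ?b" using m(1) \<delta> x by auto
    have ax: "?a \<le> x" using x m(3) \<delta> mult_left_mono[of x 1 \<delta>] by (simp add: algebra_simps)
    have xb: "x \<le> ?b" using x m(3) \<delta> by (simp add: algebra_simps)
    have "\<delta> * \<psi> ?a = integral {?a..?b} (\<lambda>_. \<psi> ?a)" using \<delta> by simp
    also have "\<dots> \<le> integral {?a..?b} \<psi>" by (intro integral_le int) (auto intro: mono)
    finally have 1: "\<psi> ?a \<le> \<xi> x" using \<Psi>[OF ab] \<delta> by (simp add: \<xi>_def field_simps)
    have "integral {?a..?b} \<psi> \<le> integral {?a..?b} (\<lambda>_. \<psi> ?b)" by (intro integral_le int) (auto intro: mono)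
    also have "\<dots> = \<delta> * \<psi> ?b" using \<delta> by simp
    finally have 2: "\<xi> x \<le> \<psi> ?b" using \<Psi>[OF ab] \<delta> by (simp add: \<xi>_def field_simps)
    have "\<psi> x = \<phi> x" using x by (simp add: \<psi>_def)
    moreover have "\<kappa> * g x = \<psi> ?b - \<psi> ?a" using \<kappa> by (simp add: g_def)
    ultimately show ?thesis using 1 2 mono[OF ax] mono[OF xb] by linarith
  qed
  note F = F_regular_integrable[OF F_set_regular[OF \<phi>]]
    F_regular_integrable[OF F_set_regular[OF admissible_differential(3)[OF adm]]]
  have ig: "integrable unit_leb g"
    by (rule integrable_unit_leb_bounded[OF g, of "1 / \<epsilon>"]) (use gb in \<open>auto simp: abs_of_nonneg\<close>)
  have "(LINT x|unit_leb. \<bar>\<xi> x - \<phi> x\<bar>) \<le> (LINT x|unit_leb. \<kappa> * g x)"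
    by (rule integral_mono) (use F ig close in auto)
  also have "\<dots> = \<epsilon> * mass\<^sup>2" using tot by (simp add: \<kappa>_def power2_eq_square)
  finally show thesis using that adm by blast
qed

lemma So_visc_le_So_inv:
  assumes "profile r" "0 < \<epsilon>" "\<epsilon> * mass < 1"
  shows "So_visc \<rho>0 \<rho>1 \<epsilon> (abs_linf r) \<le> So_inv \<rho>0 \<rho>1 (abs_linf r) + ereal (2 * (\<epsilon> * mass\<^sup>2))"
proof -
  let ?c = "2 * (\<epsilon> * mass\<^sup>2)" and ?S = "So_visc \<rho>0 \<rho>1 \<epsilon> (abs_linf r)"
  \<comment> \<open>With the constant on the left, the infimum on the right can be treated
    competitor by competitor.\<close>
  have "?S - ereal ?c \<le> So_inv \<rho>0 \<rho>1 (abs_linf r)"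
  proof (rule So_inv_ge[OF assms(1)])
    fix \<phi> assume \<phi>: "\<phi> \<in> F_set \<rho>0 \<rho>1"
    obtain \<xi> g where adm: "admissible \<epsilon> \<xi> g" and cl: "(LINT x|unit_leb. \<bar>\<xi> x - \<phi> x\<bar>) \<le> \<epsilon> * mass\<^sup>2"
      using mollify[OF \<phi> assms(2,3)] .
    have "(LINT x|unit_leb. ent (\<epsilon> * g x)) \<le> (LINT x|unit_leb. 0)"
    proof (rule integral_mono)
      fix x assume "x \<in> space unit_leb"
      then show "ent (\<epsilon> * g x) \<le> 0"
        using adm assms(2) by (intro ent_nonpos) (auto simp: admissible_def field_simps)
    qed (use integrable_ent_density[OF adm assms(2)] in auto)
    moreover have "coupling r \<xi> - coupling r \<phi> \<le> ?c"
      using coupling_lipschitz[OF assms(1) F_set_regular[OF admissible_differential(3)[OF adm]] F_set_regular[OF \<phi>]] cl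
      by linarith
    ultimately have "Ent r + (LINT x|unit_leb. ent (\<epsilon> * g x)) + coupling r \<xi> \<le> Ent r + coupling r \<phi> + ?c" by simp
    with So_visc_le[OF assms(1) adm assms(2)] have "?S \<le> ereal (Ent r + coupling r \<phi> + ?c)"
      by (meson ereal_less_eq(3) order_trans)
    then show "?S - ereal ?c \<le> ereal (Ent r + coupling r \<phi>)"
      by (cases ?S) auto
  qed
  moreover obtain s where "So_inv \<rho>0 \<rho>1 (abs_linf r) = ereal s" "ln flux_min \<le> s"
    using So_inv_real[OF assms(1)] .
  ultimately show ?thesis by (cases ?S) auto
qed

lemma So_inv_le_So_visc:
  assumes "profile r" "0 < \<epsilon>" "\<epsilon> * mass < 1"
  shows "So_inv \<rho>0 \<rho>1 (abs_linf r) + ereal (ent (\<epsilon> * mass)) \<le> So_visc \<rho>0 \<rho>1 \<epsilon> (abs_linf r)"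
proof (rule So_visc_ge[OF assms(1,2)])
  fix \<phi> g assume adm: "admissible \<epsilon> \<phi> g"
  let ?q = "\<epsilon> * mass"
  have q: "0 < ?q" "?q < 1" using assms mass_pos by auto
  have gb: "\<And>x. x \<in> {0..1} \<Longrightarrow> 0 \<le> g x \<and> g x \<le> 1 / \<epsilon>" and gm: "(LINT x|unit_leb. g x) = mass"
    and gmeas: "g \<in> borel_measurable unit_leb"
    using adm by (auto simp: admissible_def)
  have ig: "integrable unit_leb g"
    by (rule integrable_unit_leb_bounded[OF gmeas, of "1 / \<epsilon>"]) (use gb in \<open>auto simp: abs_of_nonneg\<close>)
  \<comment> \<open>Jensen's inequality through the tangent of \<open>ent\<close> at ?q, the mean of
    \<epsilon> g: the integral of the tangent along \<epsilon> g is the value at the mean.\<close>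
  have "ent ?q = (LINT x|unit_leb. (\<epsilon> * ln ?q - \<epsilon> * ln (1 - ?q)) * g x + ln (1 - ?q))"
    using ig by (simp add: gm ent_def[of ?q] unit_leb.prob_space[simplified]) (simp add: algebra_simps)
  also have "\<dots> \<le> (LINT x|unit_leb. ent (\<epsilon> * g x))"
  proof (rule integral_mono)
    fix x assume "x \<in> space unit_leb"
    then have "\<epsilon> * g x * ln ?q + (1 - \<epsilon> * g x) * ln (1 - ?q) \<le> ent (\<epsilon> * g x)"
      using gb[of x] assms(2) q by (intro gibbs) (auto simp: field_simps)
    then show "(\<epsilon> * ln ?q - \<epsilon> * ln (1 - ?q)) * g x + ln (1 - ?q) \<le> ent (\<epsilon> * g x)"
      by (simp add: algebra_simps)
  qed (use ig integrable_ent_density[OF adm assms(2)] in auto)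
  finally have J: "ent ?q \<le> (LINT x|unit_leb. ent (\<epsilon> * g x))" .
  obtain s where s: "So_inv \<rho>0 \<rho>1 (abs_linf r) = ereal s" using So_inv_real[OF assms(1)] .
  have "s \<le> Ent r + coupling r \<phi>"
    using So_inv_le[OF assms(1) admissible_differential(3)[OF adm]] s by simp
  with J s show "So_inv \<rho>0 \<rho>1 (abs_linf r) + ereal (ent ?q)
      \<le> ereal (Ent r + (LINT x|unit_leb. ent (\<epsilon> * g x)) + coupling r \<phi>)" by simp
qed

end

section \<open>Lower semicontinuity\<close>

lemma topspace_weak_star: "topspace weak_star = UNIV"
proof -
  have "{r. pairing (\<lambda>_. 0) r \<in> UNIV} \<in> {{r. pairing g r \<in> U} |g U. integrable unit_leb g \<and> open U}"
    by (intro CollectI exI[of _ "\<lambda>_. 0"] exI[of _ UNIV]) auto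
  then show ?thesis unfolding weak_star_def topology_generated_by_topspace by blast
qed

lemma topspace_M_top: "topspace M_top = M_set"
  by (simp add: M_top_def topspace_weak_star)

lemma openin_M_top_pairing:
  assumes "integrable unit_leb g" "open U"
  shows "openin M_top {\<rho> \<in> M_set. pairing g \<rho> \<in> U}"
proof -
  have "openin weak_star {\<rho>. pairing g \<rho> \<in> U}"
    unfolding weak_star_def using assms by (intro topology_generated_by_Basis) blast
  then show ?thesis
    unfolding M_top_def openin_subtopology
    by (intro exI[of _ "{\<rho>. pairing g \<rho> \<in> U}"]) auto
qed

text \<open>A primitive of - d that vanishes at 1. Being a pairing with the indicator of [y,1], each
  value is weak* continuous in d.\<close>

definition tail :: "(real \<Rightarrow> real) \<Rightarrow> real \<Rightarrow> real" where
  "tail d y = (LINT x|unit_leb. indicator {y..1} x * d x)"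

lemma integrable_indicator_mult:
  fixes d :: "real \<Rightarrow> real"
  assumes "d \<in> borel_measurable unit_leb" "\<And>x. x \<in> {0..1} \<Longrightarrow> \<bar>d x\<bar> \<le> 1" "A \<in> sets borel"
  shows "integrable unit_leb (\<lambda>x. indicator A x * d x)"
proof (rule integrable_unit_leb_bounded[of _ 1])
  have "indicator A \<in> borel_measurable unit_leb"
    using assms(3) by (intro borel_measurable_unit_leb) auto
  with assms(1) show "(\<lambda>x. indicator A x * d x) \<in> borel_measurable unit_leb"
    by (intro borel_measurable_times)
  show "\<bar>indicator A x * d x\<bar> \<le> 1" if "x \<in> {0..1}" for x
    using assms(2)[OF that] by (auto split: split_indicator)
qed

text \<open>Since d is bounded by 1, finitely many grid values of \<open>tail d\<close> control all
  others, independently of d.\<close>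

lemma tail_lipschitz:
  assumes d: "d \<in> borel_measurable unit_leb" "\<And>x. x \<in> {0..1} \<Longrightarrow> \<bar>d x\<bar> \<le> 1"
    and y: "0 \<le> y" "y \<le> z" "z \<le> 1"
  shows "\<bar>tail d y - tail d z\<bar> \<le> z - y"
proof -
  have i: "integrable unit_leb (\<lambda>x. indicator A x * d x)" if "A \<in> sets borel" for A
    by (rule integrable_indicator_mult[OF d that])
  have "tail d y - tail d z = (LINT x|unit_leb. indicator {y..1} x * d x - indicator {z..1} x * d x)"
    unfolding tail_def using i by simp
  also have "\<dots> = (LINT x|unit_leb. indicator {y..<z} x * d x)"
    using y by (intro Bochner_Integration.integral_cong) (auto split: split_indicator)
  also have "\<bar>\<dots>\<bar> \<le> (LINT x|unit_leb. \<bar>indicator {y..<z} x * d x\<bar>)"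
    by (rule integral_abs_bound)
  also have "\<dots> \<le> (LINT x|unit_leb. indicator {y..<z} x)"
  proof (rule integral_mono)
    show "integrable unit_leb (indicator {y..<z} :: real \<Rightarrow> real)"
      using i[of "{y..<z}"] integrable_indicator_mult[of "\<lambda>_. 1" "{y..<z}"] by simp
    show "\<bar>indicator {y..<z} x * d x\<bar> \<le> indicator {y..<z} x" if "x \<in> space unit_leb" for x
      using d(2)[of x] that by (auto split: split_indicator)
  qed (use i in auto)
  also have "\<dots> = measure unit_leb {y..<z}"
    using y by (subst Bochner_Integration.integral_indicator) (auto intro!: arg_cong[where f="measure unit_leb"])
  also have "\<dots> = z - y"
    using y by (subst measure_unit_leb) auto
  finally show ?thesis .
qed

context boundary_data
begin

text \<open>Integration by parts via Fubini: writing \<phi> x as \<phi>0 plus the \<mu>-integral of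
  the indicator of y \<le> x turns the integral of d \<phi> into \<phi>0 * tail d 0 plus the
  \<mu>-integral of \<open>tail d\<close>. The total mass of \<mu> is fixed, so the bound is uniform
  in \<phi>.\<close>

lemma integral_mult_F_set:
  assumes \<phi>: "\<phi> \<in> F_set \<rho>0 \<rho>1"
    and d: "d \<in> borel_measurable unit_leb" "\<And>x. x \<in> {0..1} \<Longrightarrow> \<bar>d x\<bar> \<le> 1"
    and tail: "\<And>y. y \<in> {0..1} \<Longrightarrow> \<bar>tail d y\<bar> \<le> b"
  shows "\<bar>LINT x|unit_leb. d x * \<phi> x\<bar> \<le> (\<bar>\<phi>0\<bar> + mass) * b"
proof -
  from \<phi> obtain \<mu> where \<mu>: "sets \<mu> = sets unit_leb" "finite_measure \<mu>"
    "\<And>x. x \<in> {0..1} \<Longrightarrow> \<phi> x = \<phi>0 + measure \<mu> {0..x}" "measure \<mu> {0..1} = mass"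
    by (rule F_set_obtain) (rule that)
  interpret \<mu>: finite_measure \<mu> by fact
  interpret P: pair_sigma_finite unit_leb \<mu> ..
  have sp: "space \<mu> = {0..1}" using sets_eq_imp_space_eq[OF \<mu>(1)] by simp
  note [measurable] = d(1)
  have id: "(\<lambda>x. x) \<in> borel_measurable unit_leb" by (intro borel_measurable_unit_leb) auto
  then have id': "(\<lambda>x. x) \<in> borel_measurable \<mu>" using measurable_cong_sets[OF \<mu>(1) refl] by blast
  have m1 [measurable]: "(\<lambda>p. fst p) \<in> borel_measurable (unit_leb \<Otimes>\<^sub>M \<mu>)"
    by (rule measurable_compose[OF measurable_fst id])
  have m2 [measurable]: "(\<lambda>p. snd p) \<in> borel_measurable (unit_leb \<Otimes>\<^sub>M \<mu>)"
    by (rule measurable_compose[OF measurable_snd id'])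
  have m3 [measurable]: "(\<lambda>p. d (fst p)) \<in> borel_measurable (unit_leb \<Otimes>\<^sub>M \<mu>)"
    by (rule measurable_compose[OF measurable_fst d(1)])
  have fm: "finite_measure (unit_leb \<Otimes>\<^sub>M \<mu>)"
    by (rule finite_measure_pair_measure) unfold_locales
  have int: "integrable (unit_leb \<Otimes>\<^sub>M \<mu>) (case_prod (\<lambda>x y. (if y \<le> x then 1 else 0) * d x))"
  proof (rule finite_measure.integrable_const_bound[OF fm, of _ 1])
    show "AE p in unit_leb \<Otimes>\<^sub>M \<mu>. norm (case p of (x, y) \<Rightarrow> (if y \<le> x then 1 else 0) * d x) \<le> 1"
      using d(2) by (intro AE_I2) (auto simp: space_pair_measure)
    show "(\<lambda>(x, y). (if y \<le> x then 1 else 0) * d x) \<in> borel_measurable (unit_leb \<Otimes>\<^sub>M \<mu>)"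
      unfolding case_prod_beta by measurable
  qed
  have id1: "integrable unit_leb d"
    using integrable_indicator_mult[OF d, of UNIV] by simp
  have "integrable unit_leb (\<lambda>x. LINT y|\<mu>. (if y \<le> x then 1 else 0) * d x)"
    using P.integrable_fst[OF int] .
  moreover have inner: "(LINT y|\<mu>. (if y \<le> x then 1 else 0) * d x) = d x * measure \<mu> {0..x}"
    if "x \<in> {0..1}" for x
  proof -
    have "(LINT y|\<mu>. (if y \<le> x then 1 else 0) * d x) = (LINT y|\<mu>. indicator {0..x} y * d x)"
      by (intro Bochner_Integration.integral_cong) (auto simp: sp split: split_indicator)
    also have "\<dots> = d x * measure \<mu> {0..x}"
      using that by (simp add: \<mu>(1) sp Int_absorb2 in_sets_unit_leb)
    finally show ?thesis .
  qed
  ultimately have id2: "integrable unit_leb (\<lambda>x. d x * measure \<mu> {0..x})"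
    by (subst Bochner_Integration.integrable_cong[OF refl, where g="\<lambda>x. LINT y|\<mu>. (if y \<le> x then 1 else 0) * d x"])
      (simp_all only: space_unit_leb)
  have "(LINT x|unit_leb. d x * \<phi> x) = (LINT x|unit_leb. \<phi>0 * d x + d x * measure \<mu> {0..x})"
    by (intro Bochner_Integration.integral_cong) (auto simp: \<mu>(3) algebra_simps)
  also have "\<dots> = \<phi>0 * (LINT x|unit_leb. d x) + (LINT x|unit_leb. d x * measure \<mu> {0..x})"
    using id1 id2 by simp
  also have "(LINT x|unit_leb. d x) = tail d 0"
    unfolding tail_def by (intro Bochner_Integration.integral_cong) auto
  also have "(LINT x|unit_leb. d x * measure \<mu> {0..x}) =
      (LINT x|unit_leb. LINT y|\<mu>. (if y \<le> x then 1 else 0) * d x)"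
    by (intro Bochner_Integration.integral_cong) (simp_all only: space_unit_leb inner)
  also have "\<dots> = (LINT y|\<mu>. LINT x|unit_leb. (if y \<le> x then 1 else 0) * d x)"
    by (rule P.Fubini_integral[OF int, symmetric])
  also have "\<dots> = (LINT y|\<mu>. tail d y)"
    unfolding tail_def by (intro Bochner_Integration.integral_cong) (auto simp: indicator_def)
  finally have eq: "(LINT x|unit_leb. d x * \<phi> x) = \<phi>0 * tail d 0 + (LINT y|\<mu>. tail d y)" .
  have "\<bar>LINT y|\<mu>. tail d y\<bar> \<le> (LINT y|\<mu>. \<bar>tail d y\<bar>)" by (rule integral_abs_bound)
  also have "\<dots> \<le> (LINT y|\<mu>. b)"
  proof (rule integral_mono_AE')
    show "AE x in \<mu>. \<bar>tail d x\<bar> \<le> b" using tail by (intro AE_I2) (simp add: sp)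
    show "AE x in \<mu>. 0 \<le> b" using order_trans[OF abs_ge_zero tail[of 0]] by simp
  qed simp
  also have "\<dots> = mass * b" using \<mu>(4) by (simp add: sp)
  finally have 2: "\<bar>LINT y|\<mu>. tail d y\<bar> \<le> mass * b" .
  have "\<bar>\<phi>0 * tail d 0\<bar> \<le> \<bar>\<phi>0\<bar> * b"
    unfolding abs_mult using tail[of 0] by (intro mult_left_mono) auto
  with 2 have "\<bar>\<phi>0 * tail d 0 + (LINT y|\<mu>. tail d y)\<bar> \<le> \<bar>\<phi>0\<bar> * b + mass * b"
    using abs_triangle_ineq add_mono order_trans by blast
  then show ?thesis unfolding eq by (simp add: algebra_simps)
qed

text \<open>The logarithmic term does not involve the profile and cancels, leaving the integral of
  (r' - r) \<phi>. Small tails of r' - r make it small, and V, given by finitely many pairings,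
  serves all \<phi> at once.\<close>

lemma coupling_weak_star_continuous:
  assumes r: "profile r" and \<eta>: "0 < \<eta>"
  obtains V where "openin M_top V" "abs_linf r \<in> V"
    "\<And>r' \<phi>. profile r' \<Longrightarrow> abs_linf r' \<in> V \<Longrightarrow> \<phi> \<in> F_set \<rho>0 \<rho>1 \<Longrightarrow> \<bar>coupling r \<phi> - coupling r' \<phi>\<bar> \<le> \<eta>"
proof -
  define b where "b = \<eta> / (\<bar>\<phi>0\<bar> + mass)"
  have b: "0 < b" "(\<bar>\<phi>0\<bar> + mass) * b = \<eta>" using \<eta> mass_pos by (auto simp: b_def)
  \<comment> \<open>Half of b is spent on the grid values of the tail, the other half on moving from
    y to the grid point on its left.\<close>
  obtain N :: nat where N: "0 < N" "1 / real N < b / 2"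
    using b(1) by (metis half_gt_zero nat_approx_posE zero_less_Suc)
  define h :: "nat \<Rightarrow> real \<Rightarrow> real" where "h k = indicator {real k / real N..1}" for k
  have h: "integrable unit_leb (h k)" for k
    using integrable_indicator_mult[of "\<lambda>_. 1" "{real k / real N..1}"] by (simp add: h_def)
  define V where "V = (\<Inter>k\<in>{..N}. {\<rho> \<in> M_set. pairing (h k) \<rho> \<in> ball (pairing (h k) (abs_linf r)) (b / 2)})"
  have "openin M_top V"
    unfolding V_def by (intro openin_INT2 openin_M_top_pairing h) auto
  moreover have "abs_linf r \<in> V"
    using r b abs_linf_profile_in_M by (auto simp: V_def)
  moreover have "\<bar>coupling r \<phi> - coupling r' \<phi>\<bar> \<le> \<eta>"
    if r': "profile r'" "abs_linf r' \<in> V" and \<phi>: "\<phi> \<in> F_set \<rho>0 \<rho>1" for r' \<phi>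
  proof -
    define d where "d x = r' x - r x" for x
    have d: "d \<in> borel_measurable unit_leb"
      unfolding d_def using profile_measurable[OF r] profile_measurable[OF r'(1)] by measurable
    have d_le: "\<bar>d x\<bar> \<le> 1" if "x \<in> {0..1}" for x
      unfolding d_def using profile_bounds[OF r that] profile_bounds[OF r'(1) that] by linarith
    have ih: "integrable unit_leb (\<lambda>x. q x * h k x)" if "profile q" for q k
      using integrable_indicator_mult[of q "{real k / real N..1}"] that
      by (auto simp: h_def profile_def mult.commute)
    have grid: "\<bar>tail d (real k / real N)\<bar> < b / 2" if "k \<le> N" for k
    proof -
      have "tail d (real k / real N) = (LINT x|unit_leb. r' x * h k x - r x * h k x)"
        unfolding tail_def h_def d_def by (intro Bochner_Integration.integral_cong) (auto simp: algebra_simps)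
      also have "\<dots> = pairing (h k) (abs_linf r') - pairing (h k) (abs_linf r)"
        using ih r r' h by (simp add: pairing_abs)
      finally show ?thesis using r'(2) that by (auto simp: V_def dist_real_def abs_minus_commute)
    qed
    have tl: "\<bar>tail d y\<bar> \<le> b" if y: "y \<in> {0..1}" for y
    proof -
      define k where "k = nat \<lfloor>real N * y\<rfloor>"
      have k: "real k \<le> real N * y" "real N * y < real k + 1"
        using y N by (auto simp: k_def)
      then have k': "real k / real N \<le> y" "y < real k / real N + 1 / real N"
        using N(1) by (auto simp: field_simps)
      have "real N * y \<le> real N" using y N by (simp add: mult_left_le)
      with k(1) have "k \<le> N" by linarith
      moreover have "\<bar>tail d (real k / real N) - tail d y\<bar> \<le> y - real k / real N"
        using y k' by (intro tail_lipschitz[OF d d_le]) auto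
      ultimately show ?thesis using grid[of k] k' N(2) by linarith
    qed
    have i: "integrable unit_leb (\<lambda>x. (1 - q x) * \<phi> x - ln (1 + exp (\<phi> x)))" if "profile q" for q
      using integrable_coupling[OF that F_set_regular[OF \<phi>]] .
    have "coupling r \<phi> - coupling r' \<phi> = (LINT x|unit_leb. ((1 - r x) * \<phi> x - ln (1 + exp (\<phi> x))) -
        ((1 - r' x) * \<phi> x - ln (1 + exp (\<phi> x))))"
      unfolding coupling_def by (rule Bochner_Integration.integral_diff[OF i[OF r] i[OF r'(1)], symmetric])
    also have "\<dots> = (LINT x|unit_leb. d x * \<phi> x)"
      by (intro Bochner_Integration.integral_cong) (auto simp: d_def algebra_simps)
    finally have "coupling r \<phi> - coupling r' \<phi> = (LINT x|unit_leb. d x * \<phi> x)" .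
    then show ?thesis using integral_mult_F_set[OF \<phi> d d_le tl] b(2) by simp
  qed
  ultimately show thesis by (rule that)
qed

end

text \<open>The supporting affine function of the entropy at \<open>a\<close> truncated to \<open>[\<delta>, 1 - \<delta>]\<close> has bounded
  slope and underestimates the entropy at \<open>a\<close> by at most \<open>- ent \<delta>\<close>; without truncation the slope
  would be infinite at 0 and 1.\<close>

lemma clamped_tangent:
  assumes a: "0 \<le> a" "a \<le> 1" and \<delta>: "0 < \<delta>" "\<delta> < 1/2"
  defines "q \<equiv> max \<delta> (min (1 - \<delta>) a)"
  shows "ent a + ent \<delta> \<le> a * ln q + (1 - a) * ln (1 - q)"
proof -
  have low: "ent b + ent \<delta> \<le> b * ln \<delta> + (1 - b) * ln (1 - \<delta>)" if "0 \<le> b" "b \<le> \<delta>" for b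
  proof -
    have "(\<delta> - b) * ln \<delta> \<le> (\<delta> - b) * ln (1 - \<delta>)"
      using that \<delta> by (intro mult_left_mono) auto
    then have "ent \<delta> \<le> b * ln \<delta> + (1 - b) * ln (1 - \<delta>)"
      by (simp add: ent_def algebra_simps)
    with ent_nonpos[of b] that \<delta> show ?thesis by linarith
  qed
  consider "a \<le> \<delta>" | "1 - \<delta> \<le> a" | "\<delta> < a" "a < 1 - \<delta>" by linarith
  then show ?thesis
  proof cases
    case 1
    then have "q = \<delta>" using \<delta> by (simp add: q_def)
    with low[of a] a 1 show ?thesis by simp
  next
    case 2
    then have "q = 1 - \<delta>" using \<delta> by (simp add: q_def)
    with low[of "1 - a"] a 2 show ?thesis by (simp add: ent_symmetric)
  next
    case 3
    then have "q = a" by (simp add: q_def)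
    with 3 ent_nonpos[of \<delta>] \<delta> show ?thesis by (simp add: ent_def)
  qed
qed

text \<open>At each x the tangent of \<open>ent\<close> at the truncated value of r is affine in the
  profile with bounded slope, so its integral is weak* continuous. It lies below the entropy of
  every r' and nearly touches that of r.\<close>

lemma Ent_lower_semicontinuous:
  assumes r: "profile r" and \<eta>: "0 < \<eta>"
  obtains V where "openin M_top V" "abs_linf r \<in> V"
    "\<And>r'. profile r' \<Longrightarrow> abs_linf r' \<in> V \<Longrightarrow> Ent r \<le> Ent r' + \<eta>"
proof -
  \<comment> \<open>Half of \<eta> pays for the truncation, the other half for the change of the
    pairing.\<close>
  have "eventually (\<lambda>\<delta>. - (\<eta> / 2) < ent \<delta>) (at_right 0)"
    using ent_tendsto_0 \<eta> by (intro order_tendstoD) auto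
  moreover have "eventually (\<lambda>\<delta>::real. 0 < \<delta> \<and> \<delta> < 1/2) (at_right 0)"
    by (intro eventually_at_rightI[of 0 "1/2"]) auto
  ultimately have "eventually (\<lambda>\<delta>. - (\<eta> / 2) < ent \<delta> \<and> 0 < \<delta> \<and> \<delta> < 1/2) (at_right 0)"
    by eventually_elim simp
  then obtain \<delta> where \<delta>: "- (\<eta> / 2) < ent \<delta>" "0 < \<delta>" "\<delta> < 1/2"
    using eventually_happens'[OF trivial_limit_at_right_real] by blast
  define q where "q x = max \<delta> (min (1 - \<delta>) (r x))" for x
  have q: "\<delta> \<le> q x" "q x \<le> 1 - \<delta>" for x using \<delta> by (auto simp: q_def)
  have qm [measurable]: "q \<in> borel_measurable unit_leb"
    unfolding q_def using profile_measurable[OF r] by measurable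
  define h where "h x = ln (q x) - ln (1 - q x)" for x
  define c where "c x = ln (1 - q x)" for x
  have lb: "ln \<delta> \<le> ln (q x)" "ln (q x) \<le> 0" "ln \<delta> \<le> ln (1 - q x)" "ln (1 - q x) \<le> 0" for x
    using q[of x] \<delta> by auto
  have ih: "integrable unit_leb h"
  proof (rule integrable_unit_leb_bounded[of _ "- ln \<delta>"])
    show "h \<in> borel_measurable unit_leb" unfolding h_def by measurable
    show "\<bar>h x\<bar> \<le> - ln \<delta>" for x unfolding h_def using lb[of x] by linarith
  qed
  have ic: "integrable unit_leb c"
  proof (rule integrable_unit_leb_bounded[of _ "- ln \<delta>"])
    show "c \<in> borel_measurable unit_leb" unfolding c_def by measurable
    show "\<bar>c x\<bar> \<le> - ln \<delta>" for x unfolding c_def using lb[of x] by linarith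
  qed
  have irh: "integrable unit_leb (\<lambda>x. p x * h x)" if p: "profile p" for p
  proof (rule Bochner_Integration.integrable_bound[OF ih])
    show "(\<lambda>x. p x * h x) \<in> borel_measurable unit_leb"
      using ih profile_measurable[OF p] by auto
    show "AE x in unit_leb. norm (p x * h x) \<le> norm (h x)"
      using profile_bounds[OF p] by (intro AE_I2) (auto simp: abs_mult mult_left_le_one_le)
  qed
  define V where "V = {\<rho> \<in> M_set. pairing h \<rho> \<in> {pairing h (abs_linf r) - \<eta> / 2 <..}}"
  have "openin M_top V" unfolding V_def by (rule openin_M_top_pairing[OF ih]) auto
  moreover have "abs_linf r \<in> V" using abs_linf_profile_in_M[OF r] \<eta> by (simp add: V_def)
  moreover have "Ent r \<le> Ent r' + \<eta>" if r': "profile r'" "abs_linf r' \<in> V" for r'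
  proof -
    have "Ent r - \<eta> / 2 \<le> (LINT x|unit_leb. ent (r x) + ent \<delta>)"
      using integrable_ent[OF r] \<delta> by (simp add: Ent_def unit_leb.prob_space[simplified])
    also have "\<dots> \<le> (LINT x|unit_leb. r x * h x + c x)"
    proof (rule integral_mono)
      fix x assume "x \<in> space unit_leb"
      then show "ent (r x) + ent \<delta> \<le> r x * h x + c x"
        using clamped_tangent[of "r x" \<delta>] profile_bounds[OF r, of x] \<delta>
        by (simp add: q_def[symmetric] h_def c_def algebra_simps)
    qed (use integrable_ent[OF r] irh[OF r] ic in auto)
    also have "\<dots> = pairing h (abs_linf r) + (LINT x|unit_leb. c x)"
      using irh[OF r] ic ih r by (simp add: pairing_abs)
    also have "\<dots> \<le> pairing h (abs_linf r') + \<eta> / 2 + (LINT x|unit_leb. c x)"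
      using r' by (simp add: V_def)
    also have "\<dots> = (LINT x|unit_leb. r' x * h x + c x) + \<eta> / 2"
      using irh[OF r'(1)] ic ih r' by (simp add: pairing_abs)
    also have "(LINT x|unit_leb. r' x * h x + c x) \<le> Ent r'"
      unfolding Ent_def
    proof (rule integral_mono)
      fix x assume "x \<in> space unit_leb"
      then show "r' x * h x + c x \<le> ent (r' x)"
        using gibbs[of "r' x" "q x"] profile_bounds[OF r'(1), of x] q[of x] \<delta>
        by (simp add: h_def c_def algebra_simps)
    qed (use integrable_ent[OF r'(1)] irh[OF r'(1)] ic in auto)
    finally show ?thesis by simp
  qed
  ultimately show thesis by (rule that)
qed

context boundary_data
begin

text \<open>Neither neighbourhood used here depends on \<phi>, which is what lets the estimate pass
  through the infimum.\<close>

lemma So_inv_lower_semicontinuous: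
  "lower_semicontinuous_map M_top (\<lambda>\<rho>. So_inv \<rho>0 \<rho>1 \<rho>)"
  unfolding lower_semicontinuous_map_def topspace_M_top
proof
  fix a :: ereal
  show "openin M_top {\<rho> \<in> M_set. a < So_inv \<rho>0 \<rho>1 \<rho>}"
  proof (subst openin_subopen, intro ballI)
    fix \<rho> assume "\<rho> \<in> {\<rho> \<in> M_set. a < So_inv \<rho>0 \<rho>1 \<rho>}"
    then have \<rho>: "\<rho> \<in> M_set" "a < So_inv \<rho>0 \<rho>1 \<rho>" by auto
    obtain r where r: "profile r" "\<rho> = abs_linf r" using M_set_profile[OF \<rho>(1)] .
    obtain s where s: "So_inv \<rho>0 \<rho>1 \<rho> = ereal s" using So_inv_real[OF r(1)] r(2) by metis
    obtain t where t: "a \<le> ereal t" "t < s"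
    proof (cases a)
      case (real x) with \<rho>(2) s that show ?thesis by auto
    next
      case MInf with that[of "s - 1"] show ?thesis by simp
    qed (use \<rho>(2) in simp)
    \<comment> \<open>Entropy and coupling lose one third of the gap each; the remaining third keeps
      the inequality strict.\<close>
    define \<eta> where "\<eta> = (s - t) / 3"
    have \<eta>: "0 < \<eta>" using t by (simp add: \<eta>_def)
    obtain V1 where V1: "openin M_top V1" "abs_linf r \<in> V1"
      "\<And>r'. profile r' \<Longrightarrow> abs_linf r' \<in> V1 \<Longrightarrow> Ent r \<le> Ent r' + \<eta>"
      by (rule Ent_lower_semicontinuous[OF r(1) \<eta>]) (rule that)
    obtain V2 where V2: "openin M_top V2" "abs_linf r \<in> V2"
      "\<And>r' \<phi>. profile r' \<Longrightarrow> abs_linf r' \<in> V2 \<Longrightarrow> \<phi> \<in> F_set \<rho>0 \<rho>1 \<Longrightarrow> \<bar>coupling r \<phi> - coupling r' \<phi>\<bar> \<le> \<eta>"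
      by (rule coupling_weak_star_continuous[OF r(1) \<eta>]) (rule that)
    have "V1 \<inter> V2 \<subseteq> {\<rho> \<in> M_set. a < So_inv \<rho>0 \<rho>1 \<rho>}"
    proof
      fix \<rho>' assume V: "\<rho>' \<in> V1 \<inter> V2"
      then have M: "\<rho>' \<in> M_set" using openin_subset[OF V1(1)] by (auto simp: topspace_M_top)
      obtain r' where r': "profile r'" "\<rho>' = abs_linf r'" using M_set_profile[OF M] .
      have "ereal (s - 2 * \<eta>) \<le> So_inv \<rho>0 \<rho>1 (abs_linf r')"
      proof (rule So_inv_ge[OF r'(1)])
        fix \<phi> assume \<phi>: "\<phi> \<in> F_set \<rho>0 \<rho>1"
        have "s \<le> Ent r + coupling r \<phi>" using So_inv_le[OF r(1) \<phi>] s r(2) by simp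
        with V1(3)[of r'] V2(3)[of r' \<phi>] V r' \<phi>
        show "ereal (s - 2 * \<eta>) \<le> ereal (Ent r' + coupling r' \<phi>)" by fastforce
      qed
      moreover have "t < s - 2 * \<eta>" using t by (simp add: \<eta>_def field_simps)
      ultimately have "a < So_inv \<rho>0 \<rho>1 \<rho>'"
        using t(1) r'(2) by (metis ereal_less_eq(3) less_le_trans le_less_trans less_ereal.simps(1))
      with M show "\<rho>' \<in> {\<rho> \<in> M_set. a < So_inv \<rho>0 \<rho>1 \<rho>}" by simp
    qed
    with V1 V2 r show "\<exists>T. openin M_top T \<and> \<rho> \<in> T \<and> T \<subseteq> {\<rho> \<in> M_set. a < So_inv \<rho>0 \<rho>1 \<rho>}"
      by (intro exI[of _ "V1 \<inter> V2"]) auto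
  qed
qed

end

section \<open>Calibration of the viscous functional\<close>

context boundary_data
begin

text \<open>\<epsilon> g has values in [0,1], so \<open>tail_lipschitz\<close> applies to it once
  \<phi> z is expressed through the mass to the right of z.\<close>

lemma admissible_lipschitz:
  assumes adm: "admissible \<epsilon> \<phi> g" and \<epsilon>: "0 < \<epsilon>" and x: "0 \<le> x" "x \<le> y" "y \<le> 1"
  shows "\<bar>\<phi> x - \<phi> y\<bar> \<le> (y - x) / \<epsilon>"
proof -
  define d where "d x = \<epsilon> * g x" for x
  have gm: "g \<in> borel_measurable unit_leb" and gb: "\<And>x. x \<in> {0..1} \<Longrightarrow> 0 \<le> g x \<and> g x \<le> 1 / \<epsilon>"
    using adm by (auto simp: admissible_def)
  have dm: "d \<in> borel_measurable unit_leb" using gm unfolding d_def by measurable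
  have db: "\<bar>d x\<bar> \<le> 1" if "x \<in> {0..1}" for x
    using gb[OF that] \<epsilon> by (auto simp: d_def field_simps)
  note i = integrable_indicator_mult[OF dm db]
  have id: "integrable unit_leb d" using i[of UNIV] by simp
  have "\<phi> z = \<phi>0 + mass - tail d z / \<epsilon>" if z: "z \<in> {0..1}" for z
  proof -
    have ne: "AE x in unit_leb. x \<noteq> z"
      unfolding unit_leb_def using AE_lborel_singleton[of z] by (subst AE_restrict_space_iff) auto
    have "(LINT x|unit_leb. indicator {0..z} x * d x) + tail d z =
        (LINT x|unit_leb. indicator {0..z} x * d x + indicator {z..1} x * d x)"
      unfolding tail_def using i by simp
    also have "\<dots> = (LINT x|unit_leb. d x)"
    proof (rule integral_cong_AE)
      show "AE x in unit_leb. indicator {0..z} x * d x + indicator {z..1} x * d x = d x"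
        using ne AE_space by eventually_elim (use z in \<open>auto split: split_indicator\<close>)
      show "(\<lambda>x. indicator {0..z} x * d x + indicator {z..1} x * d x) \<in> borel_measurable unit_leb"
        by (intro borel_measurable_add borel_measurable_integrable i) auto
    qed (rule dm)
    also have "\<dots> = \<epsilon> * mass" using adm by (simp add: d_def admissible_def)
    finally have "(LINT x|unit_leb. indicator {0..z} x * d x) = \<epsilon> * mass - tail d z" by simp
    moreover have "(LINT x|unit_leb. indicator {0..z} x * d x) = (LINT x|unit_leb. \<epsilon> * (indicator {0..z} x * g x))"
      by (simp add: d_def mult_ac)
    ultimately have "\<epsilon> * (\<phi> z - \<phi>0) = \<epsilon> * mass - tail d z"
      using adm z by (simp add: admissible_def)
    then show ?thesis using \<epsilon> by (simp add: field_simps)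
  qed
  then have "\<phi> x - \<phi> y = (tail d y - tail d x) / \<epsilon>"
    using x by (simp add: diff_divide_distrib)
  then have "\<bar>\<phi> x - \<phi> y\<bar> = \<bar>tail d x - tail d y\<bar> / \<epsilon>"
    using \<epsilon> by (simp add: abs_minus_commute)
  also have "\<dots> \<le> (y - x) / \<epsilon>"
    using tail_lipschitz[OF dm db x] \<epsilon> by (intro divide_right_mono) auto
  finally show ?thesis .
qed

lemma admissible_continuous:
  assumes adm: "admissible \<epsilon> \<phi> g" and \<epsilon>: "0 < \<epsilon>"
  shows "continuous_on {0..1} \<phi>" "\<phi> 0 = \<phi>0" "\<phi> 1 = \<phi>1"
proof -
  have "(1 / \<epsilon>)-lipschitz_on {0..1} \<phi>"
  proof (rule lipschitz_onI)
    fix x y :: real assume "x \<in> {0..1}" "y \<in> {0..1}"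
    then show "dist (\<phi> x) (\<phi> y) \<le> 1 / \<epsilon> * dist x y"
      using admissible_lipschitz[OF adm \<epsilon>, of x y] admissible_lipschitz[OF adm \<epsilon>, of y x]
      by (cases "x \<le> y") (auto simp: dist_real_def abs_minus_commute)
  qed (use \<epsilon> in simp)
  then show "continuous_on {0..1} \<phi>" by (rule lipschitz_on_continuous_on)
  \<comment> \<open>A general member of \<open>F_set\<close> may start above \<phi>0 because of an
    atom at 0; a density excludes this.\<close>
  have "AE x in unit_leb. x \<noteq> (0::real)"
    unfolding unit_leb_def using AE_lborel_singleton[of 0] by (subst AE_restrict_space_iff) auto
  then have "(LINT y|unit_leb. indicator {0..0} y * g y) = 0"
    by (intro integral_eq_zero_AE) (auto elim: eventually_mono)
  then show "\<phi> 0 = \<phi>0" using adm by (simp add: admissible_def)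
  have "(LINT y|unit_leb. indicator {0..1} y * g y) = (LINT y|unit_leb. g y)"
    by (intro Bochner_Integration.integral_cong) auto
  then show "\<phi> 1 = \<phi>1" using adm by (simp add: admissible_def)
qed

text \<open>The image of \<open>d\<phi>\<close> under \<open>\<phi>\<close> is Lebesgue measure on \<open>[\<phi>0,\<phi>1]\<close>. This replaces the chain rule
  for \<open>W \<circ> \<phi>\<close>, where \<open>\<phi>\<close> is only differentiable almost everywhere.\<close>

lemma cdf_distr_admissible:
  assumes adm: "admissible \<epsilon> \<phi> g" and \<epsilon>: "0 < \<epsilon>"
  defines "\<nu> \<equiv> density unit_leb (\<lambda>x. ennreal (g x))"
  shows "cdf (distr \<nu> borel \<phi>) t = (if t < \<phi>0 then 0 else if \<phi>1 \<le> t then mass else t - \<phi>0)"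
    and "finite_borel_measure (distr \<nu> borel \<phi>)"
proof -
  note dif = admissible_differential[OF adm, folded \<nu>_def]
  note F = F_set_mono[OF dif(3)]
  note c = admissible_continuous[OF adm \<epsilon>]
  have \<phi>m: "\<phi> \<in> borel_measurable \<nu>"
    using F_set_regular[OF dif(3)] by (simp add: \<nu>_def F_regular_def)
  have sp: "space \<nu> = {0..1}" by (simp add: \<nu>_def)
  have val: "measure \<nu> {0..x} = \<phi> x - \<phi>0" if "x \<in> {0..1}" for x
    using dif(1) that by (simp add: is_differential_def)
  show "finite_borel_measure (distr \<nu> borel \<phi>)"
    using finite_measure.finite_measure_distr[OF dif(4) \<phi>m]
    by (simp add: finite_borel_measure_def finite_borel_measure_axioms_def)
  have eq: "cdf (distr \<nu> borel \<phi>) t = measure \<nu> ({0..1} \<inter> \<phi> -` {..t})"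
    unfolding cdf_def by (subst measure_distr[OF \<phi>m]) (auto simp: sp Int_commute)
  consider "t < \<phi>0" | "\<phi>1 \<le> t" "\<phi>0 \<le> t" | "\<phi>0 \<le> t" "t < \<phi>1" by linarith
  then show "cdf (distr \<nu> borel \<phi>) t = (if t < \<phi>0 then 0 else if \<phi>1 \<le> t then mass else t - \<phi>0)"
  proof cases
    case 1
    then have "{0..1} \<inter> \<phi> -` {..t} = {}" using F(2) by force
    with 1 show ?thesis by (simp add: eq)
  next
    case 2
    then have "{0..1} \<inter> \<phi> -` {..t} = {0..1}" using F(2) by force
    with 2 dif(2) show ?thesis by (simp add: eq)
  next
    case 3
    \<comment> \<open>\<phi> can be constant on intervals, so t may have many preimages. The largest
      point z of the sublevel set is one of them, and monotonicity makes the set equal to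
      [0,z].\<close>
    let ?S = "{0..1} \<inter> \<phi> -` {..t}"
    have "closed ?S" by (intro continuous_closed_preimage c) auto
    then have "compact ?S" using compact_Int_closed[of "{0..1}" ?S] by simp
    moreover have "0 \<in> ?S" using c 3 by auto
    ultimately obtain z where z: "z \<in> ?S" "\<And>x. x \<in> ?S \<Longrightarrow> x \<le> z"
      using compact_attains_sup[of ?S] by blast
    from z(1) have z': "z \<in> {0..1}" by simp
    have "\<exists>y. 0 \<le> y \<and> y \<le> 1 \<and> \<phi> y = t" using c 3 by (intro IVT') auto
    then obtain y where y: "y \<in> {0..1}" "\<phi> y = t" by auto
    have "y \<le> z" using z(2)[of y] y by auto
    then have "\<phi> z = t" using F(1) y z(1) by (intro antisym) (auto simp: mono_on_def)
    moreover have "?S = {0..z}"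
    proof (intro subset_antisym subsetI)
      fix x assume "x \<in> ?S"
      with z(2)[of x] show "x \<in> {0..z}" by simp
    next
      fix x assume x: "x \<in> {0..z}"
      with z(1) have x': "x \<in> {0..1}" by simp
      then have "\<phi> x \<le> \<phi> z" using x z(1) by (intro mono_onD[OF F(1)]) simp_all
      with x' z(1) show "x \<in> ?S" by simp
    qed
    ultimately show ?thesis using 3 val[OF z'] by (simp add: eq)
  qed
qed

text \<open>g w(\<phi>) is a null Lagrangian: both sides integrate w against the same image measure.
  Comparing two curves makes it unnecessary to evaluate the common value.\<close>

lemma integral_along_admissible:
  assumes adm: "admissible \<epsilon> \<phi> g" "admissible \<epsilon> \<phi>' g'" and \<epsilon>: "0 < \<epsilon>"
    and w: "w \<in> borel_measurable borel"
  shows "(LINT x|unit_leb. g x * w (\<phi> x)) = (LINT x|unit_leb. g' x * w (\<phi>' x))"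
proof -
  define D where "D \<phi> g = distr (density unit_leb (\<lambda>x. ennreal (g x))) borel \<phi>"
    for \<phi> :: "real \<Rightarrow> real" and g :: "real \<Rightarrow> real"
  have "D \<phi> g = D \<phi>' g'"
    unfolding D_def using cdf_distr_admissible[OF adm(1) \<epsilon>] cdf_distr_admissible[OF adm(2) \<epsilon>]
    by (intro cdf_unique' ext) auto
  moreover have "(LINT x|unit_leb. g x * w (\<phi> x)) = (LINT y|D \<phi> g. w y)" if adm: "admissible \<epsilon> \<phi> g" for \<phi> g
  proof -
    have \<phi>m [measurable]: "\<phi> \<in> borel_measurable unit_leb"
      using F_set_regular[OF admissible_differential(3)[OF adm]] by (simp add: F_regular_def)
    have g [measurable]: "g \<in> borel_measurable unit_leb" and gb: "\<And>x. x \<in> {0..1} \<Longrightarrow> 0 \<le> g x"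
      using adm by (auto simp: admissible_def)
    note [measurable] = w
    have "(LINT y|D \<phi> g. w y) = (LINT x|density unit_leb (\<lambda>x. ennreal (g x)). w (\<phi> x))"
      unfolding D_def by (rule integral_distr) auto
    also have "\<dots> = (LINT x|unit_leb. g x *\<^sub>R w (\<phi> x))"
      by (rule integral_density) (use gb in \<open>auto intro!: AE_I2\<close>)
    finally show ?thesis by simp
  qed
  ultimately show ?thesis using adm by metis
qed

lemma admissible_of_derivative:
  assumes d: "\<And>x. x \<in> {0..1} \<Longrightarrow> (\<phi> has_real_derivative g x) (at x within {0..1})"
    and c: "continuous_on {0..1} g" and b: "\<And>x. x \<in> {0..1} \<Longrightarrow> 0 \<le> g x \<and> g x \<le> 1 / \<epsilon>"
    and bd: "\<phi> 0 = \<phi>0" "\<phi> 1 = \<phi>1"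
  shows "admissible \<epsilon> \<phi> g"
proof -
  have gm: "g \<in> borel_measurable unit_leb"
    using borel_measurable_continuous_on_restrict[OF c] measurable_cong_sets[OF sets_unit_leb refl] by blast
  have "(g has_integral \<phi> x - \<phi> 0) {0..x}" if "x \<in> {0..1}" for x
    using that
    by (intro fundamental_theorem_of_calculus)
      (auto simp: has_real_derivative_iff_has_vector_derivative[symmetric] intro!: DERIV_subset[OF d])
  then have L: "(LINT y|unit_leb. indicator {0..x} y * g y) = \<phi> x - \<phi>0" if "x \<in> {0..1}" for x
    using that bd by (intro integral_unit_leb_initial[OF gm b]) auto
  have "(LINT y|unit_leb. g y) = (LINT y|unit_leb. indicator {0..1} y * g y)"
    by (intro Bochner_Integration.integral_cong) auto
  then show ?thesis unfolding admissible_def using gm b L L[of 1] bd by auto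
qed

text \<open>The Lagrangian \<open>s(\<epsilon>\<phi>\<^sub>x) + log F(\<phi>)\<close> has the conserved quantity \<open>J = (1 - \<epsilon>\<phi>\<^sub>x) F(\<phi>)\<close>;
  \<open>\<epsilon> log ((F - J) / J)\<close> is its momentum along the stationary solution.\<close>

definition momentum :: "real \<Rightarrow> real \<Rightarrow> real \<Rightarrow> real" where
  "momentum \<epsilon> J t = \<epsilon> * ln ((exp (t - 2 * ln (1 + exp t)) - J) / J)"

text \<open>The left side is ln F plus the tangent of \<open>ent\<close> at (F - J) / F, the slope
  prescribed by the conserved quantity. On the right F survives only in the coefficient of a: the
  constant term ln J is the same at every point, as a calibration requires.\<close>

lemma ent_flux_split:
  fixes a J F :: real
  assumes "0 < J" "J < F"
  shows "a * ln ((F - J) / F) + (1 - a) * ln (1 - (F - J) / F) + ln F = a * ln ((F - J) / J) + ln J"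
proof -
  have "F \<noteq> 0" using assms by simp
  then have 1: "1 - (F - J) / F = J / F" by (simp add: diff_divide_distrib)
  have 2: "ln ((F - J) / F) = ln (F - J) - ln F" "ln (J / F) = ln J - ln F"
    "ln ((F - J) / J) = ln (F - J) - ln J"
    using assms by (auto simp: ln_div)
  show ?thesis unfolding 1 2 by (simp add: algebra_simps)
qed

text \<open>Two Gibbs inequalities, one for the density r and one for the scaled slope \<epsilon> g,
  bound the integrand of any competitor below by g w(\<phi>) + ln J. Both are equalities along b,
  and the integral of g w(\<phi>) is the same for all admissible pairs.\<close>

lemma stationary_minimizes:
  assumes \<epsilon>: "0 < \<epsilon>" and J: "0 < J" "J < flux_min"
    and b: "profile b" "\<And>x. x \<in> {0..1} \<Longrightarrow> \<rho>0 \<le> b x \<and> b x \<le> \<rho>1"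
    and adm: "admissible \<epsilon> (\<lambda>x. bdry_phi (b x)) (\<lambda>x. (1 - J / flux (b x)) / \<epsilon>)"
    and r: "profile r"
  shows "So_visc \<rho>0 \<rho>1 \<epsilon> (abs_linf b) \<le> So_visc \<rho>0 \<rho>1 \<epsilon> (abs_linf r)"
proof (rule So_visc_ge[OF r \<epsilon>])
  fix \<phi> g assume adm': "admissible \<epsilon> \<phi> g"
  let ?w = "momentum \<epsilon> J" and ?F = "\<lambda>t. exp (t - 2 * ln (1 + exp t)) :: real"
  let ?\<psi> = "\<lambda>x. bdry_phi (b x)" and ?h = "\<lambda>x. (1 - J / flux (b x)) / \<epsilon>"
  have w [measurable]: "?w \<in> borel_measurable borel" unfolding momentum_def[abs_def] by measurable
  have F: "flux_min \<le> ?F t" "?F t \<le> exp \<phi>1" if "\<phi>0 \<le> t" "t \<le> \<phi>1" for t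
  proof -
    have "exp (ln flux_min) \<le> ?F t" using ln_flux_min_le[OF that] by simp
    then show "flux_min \<le> ?F t" using flux_min_pos by simp
    have "0 \<le> ln (1 + exp t)" by simp
    with that have "t - 2 * ln (1 + exp t) \<le> \<phi>1" by linarith
    then show "?F t \<le> exp \<phi>1" by simp
  qed
  \<comment> \<open>J < \<open>flux_min\<close> keeps the argument of the logarithm away from 0, so
    the momentum is bounded on [\<phi>0, \<phi>1].\<close>
  define B where "B = \<epsilon> * (\<bar>ln ((flux_min - J) / J)\<bar> + \<bar>ln ((exp \<phi>1) / J)\<bar>)"
  have wB: "\<bar>?w t\<bar> \<le> B" if "\<phi>0 \<le> t" "t \<le> \<phi>1" for t
  proof -
    have "ln ((flux_min - J) / J) \<le> ln ((?F t - J) / J)"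
      using F[OF that] J by (subst ln_le_cancel_iff) (auto intro: divide_right_mono)
    moreover have "(?F t - J) / J \<le> exp \<phi>1 / J"
      using F(2)[OF that] J by (intro divide_right_mono) linarith+
    then have "ln ((?F t - J) / J) \<le> ln (exp \<phi>1 / J)"
      using F(1)[OF that] J by (subst ln_le_cancel_iff) auto
    ultimately have "\<bar>ln ((?F t - J) / J)\<bar> \<le> \<bar>ln ((flux_min - J) / J)\<bar> + \<bar>ln ((exp \<phi>1) / J)\<bar>"
      by linarith
    then show ?thesis unfolding momentum_def B_def abs_mult using \<epsilon> by simp
  qed
  have int: "integrable unit_leb (\<lambda>x. g x * ?w (\<phi> x))" if adm: "admissible \<epsilon> \<phi> g" for \<phi> g
  proof (rule integrable_unit_leb_bounded[of _ "1 / \<epsilon> * B"])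
    have reg: "F_regular \<phi>" using F_set_regular[OF admissible_differential(3)[OF adm]] .
    then have [measurable]: "\<phi> \<in> borel_measurable unit_leb" by (simp add: F_regular_def)
    have [measurable]: "g \<in> borel_measurable unit_leb" using adm by (simp add: admissible_def)
    show "(\<lambda>x. g x * ?w (\<phi> x)) \<in> borel_measurable unit_leb" by measurable
    show "\<bar>g x * ?w (\<phi> x)\<bar> \<le> 1 / \<epsilon> * B" if "x \<in> {0..1}" for x
      unfolding abs_mult using that adm wB[of "\<phi> x"] reg \<epsilon>
      by (intro mult_mono) (auto simp: admissible_def F_regular_def)
  qed
  have val: "Ent r + (LINT x|unit_leb. ent (\<epsilon> * g x)) + coupling r \<phi> =
      (LINT x|unit_leb. ent (r x) + ent (\<epsilon> * g x) + ((1 - r x) * \<phi> x - ln (1 + exp (\<phi> x))))"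
    if r: "profile r" and adm: "admissible \<epsilon> \<phi> g" for r \<phi> g
    using integrable_ent[OF r] integrable_ent_density[OF adm \<epsilon>]
      integrable_coupling[OF r F_set_regular[OF admissible_differential(3)[OF adm]]]
    by (simp add: Ent_def coupling_def)
  have integrable_value: "integrable unit_leb
      (\<lambda>x. ent (r x) + ent (\<epsilon> * g x) + ((1 - r x) * \<phi> x - ln (1 + exp (\<phi> x))))"
    if r: "profile r" and adm: "admissible \<epsilon> \<phi> g" for r \<phi> g
    using integrable_ent[OF r] integrable_ent_density[OF adm \<epsilon>]
      integrable_coupling[OF r F_set_regular[OF admissible_differential(3)[OF adm]]] by simp
  have "So_visc \<rho>0 \<rho>1 \<epsilon> (abs_linf b) \<le> ereal (Ent b + (LINT x|unit_leb. ent (\<epsilon> * ?h x)) + coupling b ?\<psi>)"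
    by (rule So_visc_le[OF b(1) adm \<epsilon>])
  also have "Ent b + (LINT x|unit_leb. ent (\<epsilon> * ?h x)) + coupling b ?\<psi> =
      (LINT x|unit_leb. ?h x * ?w (?\<psi> x) + ln J)"
    unfolding val[OF b(1) adm]
  proof (rule Bochner_Integration.integral_cong[OF refl])
    fix x assume "x \<in> space unit_leb"
    then have bx: "\<rho>0 \<le> b x" "b x \<le> \<rho>1" "0 < b x" "b x < 1" using b(2)[of x] pos less1 by auto
    define f where "f = flux (b x)"
    have f: "J < f" "0 < f" using flux_min_le[OF bx(1,2)] J by (auto simp: f_def)
    have q: "\<epsilon> * ?h x = (f - J) / f" using \<epsilon> f by (simp add: f_def[symmetric] field_simps)
    have "(f - J) / f > 0" "(f - J) / f < 1" using f J by (auto simp: field_simps)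
    then have "ent (\<epsilon> * ?h x) + ln f = (\<epsilon> * ?h x) * ln ((f - J) / J) + ln J"
      unfolding q using ent_def[of "(f - J) / f"] ent_flux_split[OF J(1) f(1), of "(f - J) / f"] by simp
    moreover have "ent (b x) + ((1 - b x) * ?\<psi> x - ln (1 + exp (?\<psi> x))) = ln f"
      using ent_dual_eq bx by (simp add: f_def)
    moreover have "?h x * ?w (?\<psi> x) = (\<epsilon> * ?h x) * ln ((f - J) / J)"
      using f bx by (simp add: momentum_def ln_flux_logistic f_def)
    ultimately show "ent (b x) + ent (\<epsilon> * ?h x) + ((1 - b x) * ?\<psi> x - ln (1 + exp (?\<psi> x)))
        = ?h x * ?w (?\<psi> x) + ln J"
      by linarith
  qed
  also have "\<dots> = (LINT x|unit_leb. ?h x * ?w (?\<psi> x)) + ln J"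
    using int[OF adm] by (simp add: unit_leb.prob_space[simplified])
  also have "\<dots> = (LINT x|unit_leb. g x * ?w (\<phi> x)) + ln J"
    using integral_along_admissible[OF adm adm' \<epsilon> w] by simp
  also have "\<dots> = (LINT x|unit_leb. g x * ?w (\<phi> x) + ln J)"
    using int[OF adm'] by (simp add: unit_leb.prob_space[simplified])
  also have "\<dots> \<le> (LINT x|unit_leb. ent (r x) + ent (\<epsilon> * g x) + ((1 - r x) * \<phi> x - ln (1 + exp (\<phi> x))))"
  proof (rule integral_mono)
    fix x assume "x \<in> space unit_leb"
    then have x: "x \<in> {0..1}" by simp
    have t: "\<phi>0 \<le> \<phi> x" "\<phi> x \<le> \<phi>1"
      using F_set_mono(2)[OF admissible_differential(3)[OF adm'] x] by auto
    define f where "f = ?F (\<phi> x)"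
    have f: "J < f" "0 < f" using F[OF t] J by (auto simp: f_def)
    have "0 \<le> \<epsilon> * g x" "\<epsilon> * g x \<le> 1"
      using adm' x \<epsilon> by (auto simp: admissible_def field_simps)
    moreover have "(f - J) / f > 0" "(f - J) / f < 1" using f J by (auto simp: field_simps)
    ultimately have "(\<epsilon> * g x) * ln ((f - J) / J) + ln J \<le> ent (\<epsilon> * g x) + ln f"
      unfolding ent_flux_split[OF J(1) f(1), symmetric] using gibbs[of "\<epsilon> * g x" "(f - J) / f"] by simp
    moreover have "ln f \<le> ent (r x) + ((1 - r x) * \<phi> x - ln (1 + exp (\<phi> x)))"
      using ent_dual[of "r x" "\<phi> x"] profile_bounds[OF r x] by (simp add: f_def)
    moreover have "g x * ?w (\<phi> x) = (\<epsilon> * g x) * ln ((f - J) / J)"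
      by (simp add: momentum_def f_def)
    ultimately show "g x * ?w (\<phi> x) + ln J \<le>
        ent (r x) + ent (\<epsilon> * g x) + ((1 - r x) * \<phi> x - ln (1 + exp (\<phi> x)))" by linarith
  qed (use int[OF adm'] integrable_value[OF r adm'] in auto)
  also have "\<dots> = Ent r + (LINT x|unit_leb. ent (\<epsilon> * g x)) + coupling r \<phi>"
    by (rule val[OF r adm', symmetric])
  finally show "So_visc \<rho>0 \<rho>1 \<epsilon> (abs_linf b) \<le> ereal (Ent r + (LINT x|unit_leb. ent (\<epsilon> * g x)) + coupling r \<phi>)"
    by simp
qed

end

section \<open>The viscous stationary solution\<close>

text \<open>A primitive of \<open>1 / (flux - J)\<close>; it is \<open>artanh ((a - 1/2) / \<kappa>) / \<kappa>\<close> for \<open>\<kappa> = sqrt (1/4 - J)\<close>.\<close>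
definition flux_primitive :: "real \<Rightarrow> real \<Rightarrow> real" where
  "flux_primitive J a = (ln (sqrt (1/4 - J) + (a - 1/2)) - ln (sqrt (1/4 - J) - (a - 1/2))) / (2 * sqrt (1/4 - J))"

lemma flux_sq: "flux a = 1/4 - (a - 1/2)\<^sup>2"
  by (simp add: flux_def power2_eq_square algebra_simps)

lemma abs_less_sqrt:
  assumes "J < flux a"
  shows "\<bar>a - 1/2\<bar> < sqrt (1/4 - J)" "0 < sqrt (1/4 - J)"
proof -
  have "\<bar>a - 1/2\<bar>\<^sup>2 < 1/4 - J" using assms by (simp add: flux_sq)
  then show "\<bar>a - 1/2\<bar> < sqrt (1/4 - J)" by (rule real_less_rsqrt)
  then show "0 < sqrt (1/4 - J)" by linarith
qed

lemma has_derivative_flux_primitive: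
  assumes "J < flux a"
  shows "(flux_primitive J has_real_derivative 1 / (flux a - J)) (at a)"
proof -
  define \<kappa> where "\<kappa> = sqrt (1/4 - J)"
  have \<kappa>: "\<bar>a - 1/2\<bar> < \<kappa>" "0 < \<kappa>" using abs_less_sqrt[OF assms] by (auto simp: \<kappa>_def)
  have sq: "\<kappa>\<^sup>2 = 1/4 - J"
    unfolding \<kappa>_def using \<kappa>(2) by (simp add: \<kappa>_def)
  have p: "0 < \<kappa> + (a - 1/2)" "0 < \<kappa> - (a - 1/2)" using \<kappa> by linarith+
  have two: "\<kappa> + (a - 1/2) + (\<kappa> - (a - 1/2)) = 2 * \<kappa>" by simp
  have prod: "(\<kappa> + d) * (\<kappa> - d) = \<kappa>\<^sup>2 - d\<^sup>2" for d
    by (simp add: power2_eq_square algebra_simps)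
  have frac: "1 / b - (- 1) / c = (b + c) / (b * c)" if "0 < b" "0 < c" for b c :: real
    using that by (simp add: field_simps)
  have d1: "((\<lambda>a. ln (\<kappa> + (a - 1/2))) has_real_derivative 1 / (\<kappa> + (a - 1/2)) * 1) (at a)"
    by (rule DERIV_chain2[where f=ln and g="\<lambda>a. \<kappa> + (a - 1/2)", OF DERIV_ln_divide[OF p(1)]]) (auto intro!: derivative_eq_intros)
  have d2: "((\<lambda>a. ln (\<kappa> - (a - 1/2))) has_real_derivative 1 / (\<kappa> - (a - 1/2)) * (- 1)) (at a)"
    by (rule DERIV_chain2[where f=ln and g="\<lambda>a. \<kappa> - (a - 1/2)", OF DERIV_ln_divide[OF p(2)]]) (auto intro!: derivative_eq_intros)
  have "((\<lambda>a. (ln (\<kappa> + (a - 1/2)) - ln (\<kappa> - (a - 1/2))) / (2 * \<kappa>)) has_real_derivative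
      (1 / (\<kappa> + (a - 1/2)) - (- 1) / (\<kappa> - (a - 1/2))) / (2 * \<kappa>)) (at a)"
    using DERIV_cdivide[OF DERIV_diff[OF d1 d2], of "2 * \<kappa>"] by simp
  also have "1 / (\<kappa> + (a - 1/2)) - (- 1) / (\<kappa> - (a - 1/2)) = 2 * \<kappa> / ((\<kappa> + (a - 1/2)) * (\<kappa> - (a - 1/2)))"
    unfolding frac[OF p] two ..
  also have "(\<kappa> + (a - 1/2)) * (\<kappa> - (a - 1/2)) = flux a - J"
    using prod[of "a - 1/2"] sq flux_sq[of a] by linarith
  finally show ?thesis
    using \<kappa> unfolding flux_primitive_def[abs_def] \<kappa>_def[symmetric] by simp
qed

text \<open>Inverts the primitive; at the two boundary densities it yields the boundary values of
  the explicit tanh profile.\<close>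

lemma tanh_flux_primitive:
  assumes "J < flux a"
  shows "sqrt (1/4 - J) * tanh (sqrt (1/4 - J) * flux_primitive J a) = a - 1/2"
proof -
  define \<kappa> where "\<kappa> = sqrt (1/4 - J)"
  have \<kappa>: "\<bar>a - 1/2\<bar> < \<kappa>" "0 < \<kappa>" using abs_less_sqrt[OF assms] by (auto simp: \<kappa>_def)
  have p: "0 < \<kappa> + (a - 1/2)" "0 < \<kappa> - (a - 1/2)" using \<kappa> by linarith+
  have frac: "(1 - c / b) / (1 + c / b) = (b - c) / (b + c)" if "0 < b" "0 < c" for b c :: real
    using that by (simp add: divide_simps)
  have "- 2 * (\<kappa> * flux_primitive J a) = ln (\<kappa> - (a - 1/2)) - ln (\<kappa> + (a - 1/2))"
    using \<kappa> by (simp add: flux_primitive_def \<kappa>_def[symmetric])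
  also have "\<dots> = ln ((\<kappa> - (a - 1/2)) / (\<kappa> + (a - 1/2)))" using p by (simp add: ln_div)
  finally have "exp (- 2 * (\<kappa> * flux_primitive J a)) = (\<kappa> - (a - 1/2)) / (\<kappa> + (a - 1/2))"
    using p by simp
  then have "tanh (\<kappa> * flux_primitive J a) = (1 - (\<kappa> - (a - 1/2)) / (\<kappa> + (a - 1/2))) / (1 + (\<kappa> - (a - 1/2)) / (\<kappa> + (a - 1/2)))"
    by (simp add: tanh_real_altdef)
  also have "\<dots> = ((\<kappa> + (a - 1/2)) - (\<kappa> - (a - 1/2))) / ((\<kappa> + (a - 1/2)) + (\<kappa> - (a - 1/2)))"
    by (rule frac[OF p])
  also have "(\<kappa> + (a - 1/2)) - (\<kappa> - (a - 1/2)) = 2 * (a - 1/2)" by simp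
  also have "(\<kappa> + (a - 1/2)) + (\<kappa> - (a - 1/2)) = 2 * \<kappa>" by simp
  finally have "tanh (\<kappa> * flux_primitive J a) = (a - 1/2) / \<kappa>" by (subst (asm) mult_divide_mult_cancel_left) simp_all
  then show ?thesis using \<kappa> by (simp add: \<kappa>_def[symmetric])
qed

section \<open>Existence and uniqueness of the flux constant\<close>

context boundary_data
begin

lemma INF_flux: "(INF a\<in>{\<rho>0..\<rho>1}. flux a) = flux_min"
proof (rule cInf_eq_minimum)
  show "flux_min \<in> flux ` {\<rho>0..\<rho>1}"
    using less by (auto simp: flux_min_def min_def)
qed (use flux_min_le in auto)

lemma has_integral_flux_primitive:
  assumes "J < flux_min"
  shows "((\<lambda>a. \<epsilon> / (flux a - J)) has_integral \<epsilon> * (flux_primitive J \<rho>1 - flux_primitive J \<rho>0)) {\<rho>0..\<rho>1}"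
proof -
  have "((\<lambda>a. 1 / (flux a - J)) has_integral flux_primitive J \<rho>1 - flux_primitive J \<rho>0) {\<rho>0..\<rho>1}"
  proof (rule fundamental_theorem_of_calculus)
    fix a assume "a \<in> {\<rho>0..\<rho>1}"
    then have "J < flux a" using assms flux_min_le[of a] by auto
    then show "(flux_primitive J has_vector_derivative 1 / (flux a - J)) (at a within {\<rho>0..\<rho>1})"
      unfolding has_real_derivative_iff_has_vector_derivative[symmetric]
      by (rule has_field_derivative_at_within[OF has_derivative_flux_primitive])
  qed (use less in simp)
  from has_integral_mult_right[OF this, of \<epsilon>] show ?thesis by simp
qed

text \<open>From the endpoint of minimal flux the flux grows with slope at most 1, so the integrand
  is at least 1 / (h + s) at distance s from it. Its integral thus exceeds every bound as J rises to
  \<open>flux_min\<close>.\<close>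

lemma flux_primitive_blows_up:
  assumes h: "0 < h"
  shows "ln ((\<rho>1 - \<rho>0) / h) \<le> flux_primitive (flux_min - h) \<rho>1 - flux_primitive (flux_min - h) \<rho>0"
proof -
  define L where "L = \<rho>1 - \<rho>0"
  have L: "0 < L" using less by (simp add: L_def)
  have I: "((\<lambda>a. 1 / (flux a - (flux_min - h))) has_integral
      flux_primitive (flux_min - h) \<rho>1 - flux_primitive (flux_min - h) \<rho>0) {\<rho>0..\<rho>1}"
    using has_integral_flux_primitive[of "flux_min - h" 1] h by simp
  have comp: "ln (h + L) - ln h \<le> flux_primitive (flux_min - h) \<rho>1 - flux_primitive (flux_min - h) \<rho>0"
    if G: "\<And>a. a \<in> {\<rho>0..\<rho>1} \<Longrightarrow> (G has_real_derivative 1 / D a) (at a)"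
      and D: "\<And>a. a \<in> {\<rho>0..\<rho>1} \<Longrightarrow> flux a - (flux_min - h) \<le> D a"
      and val: "G \<rho>1 - G \<rho>0 = ln (h + L) - ln h" for G D
  proof -
    have "((\<lambda>a. 1 / D a) has_integral G \<rho>1 - G \<rho>0) {\<rho>0..\<rho>1}"
      using less G
      by (intro fundamental_theorem_of_calculus)
        (auto simp: has_real_derivative_iff_has_vector_derivative[symmetric] intro: has_field_derivative_at_within)
    then have "G \<rho>1 - G \<rho>0 \<le> flux_primitive (flux_min - h) \<rho>1 - flux_primitive (flux_min - h) \<rho>0"
    proof (rule has_integral_le[OF _ I])
      fix a assume a: "a \<in> {\<rho>0..\<rho>1}"
      then have "0 < flux a - (flux_min - h)" using flux_min_le[of a] h by auto
      then show "1 / D a \<le> 1 / (flux a - (flux_min - h))"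
        using D[OF a] by (intro divide_left_mono mult_pos_pos) auto
    qed
    then show ?thesis using val by simp
  qed
  have "ln (h + L) - ln h \<le> flux_primitive (flux_min - h) \<rho>1 - flux_primitive (flux_min - h) \<rho>0"
  proof (cases "flux \<rho>0 \<le> flux \<rho>1")
    case True
    then have m: "flux_min = flux \<rho>0" by (simp add: flux_min_def)
    show ?thesis
    proof (rule comp[of "\<lambda>a. ln (h + (a - \<rho>0))" "\<lambda>a. h + (a - \<rho>0)"])
      fix a assume a: "a \<in> {\<rho>0..\<rho>1}"
      show "((\<lambda>a. ln (h + (a - \<rho>0))) has_real_derivative 1 / (h + (a - \<rho>0))) (at a)"
        using a h by (auto intro!: derivative_eq_intros)
      have "flux a - flux \<rho>0 = (a - \<rho>0) * (1 - (\<rho>0 + a))" by (simp add: flux_def algebra_simps)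
      also have "\<dots> \<le> (a - \<rho>0) * 1" using a pos by (intro mult_left_mono) auto
      finally show "flux a - (flux_min - h) \<le> h + (a - \<rho>0)" by (simp add: m)
    qed (simp add: L_def)
  next
    case False
    then have m: "flux_min = flux \<rho>1" by (simp add: flux_min_def)
    show ?thesis
    proof (rule comp[of "\<lambda>a. - ln (h + (\<rho>1 - a))" "\<lambda>a. h + (\<rho>1 - a)"])
      fix a assume a: "a \<in> {\<rho>0..\<rho>1}"
      show "((\<lambda>a. - ln (h + (\<rho>1 - a))) has_real_derivative 1 / (h + (\<rho>1 - a))) (at a)"
        using a h by (auto intro!: derivative_eq_intros)
      have "flux a - flux \<rho>1 = (\<rho>1 - a) * ((\<rho>1 + a) - 1)" by (simp add: flux_def algebra_simps)
      also have "\<dots> \<le> (\<rho>1 - a) * 1" using a less1 by (intro mult_left_mono) auto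
      finally show "flux a - (flux_min - h) \<le> h + (\<rho>1 - a)" by (simp add: m)
    qed (simp add: L_def)
  qed
  moreover have "ln (L / h) \<le> ln (h + L) - ln h"
    using L h by (simp add: ln_div)
  ultimately show ?thesis by (simp add: L_def)
qed

lemma ex_flux_level:
  assumes \<epsilon>: "0 < \<epsilon>" "\<epsilon> * mass < 1"
  obtains J where "0 < J" "J < flux_min" "flux_primitive J \<rho>1 - flux_primitive J \<rho>0 = 1 / \<epsilon>"
proof -
  define P where "P J = flux_primitive J \<rho>1 - flux_primitive J \<rho>0" for J
  \<comment> \<open>The first entry keeps flux_min - h positive, the second makes the logarithmic
    lower bound at least 1 / \<epsilon>.\<close>
  define h where "h = min (flux_min / 2) ((\<rho>1 - \<rho>0) / exp (1 / \<epsilon>))"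
  have h: "0 < h" "h < flux_min" "h \<le> (\<rho>1 - \<rho>0) / exp (1 / \<epsilon>)"
    using flux_min_pos less by (auto simp: h_def min_less_iff_disj)
  have sq: "sqrt (1/4) = (1/2 :: real)" by (rule real_sqrt_unique) (auto simp: power2_eq_square)
  \<comment> \<open>At J = 0 the primitive is ln (a / (1 - a)). Here \<epsilon> * mass < 1 places
    the root strictly above 0, as needed for ln J in the calibration.\<close>
  have "P 0 = mass"
    using pos less less1 by (simp add: P_def flux_primitive_def sq bdry_phi_eq)
  moreover have "mass < 1 / \<epsilon>" using \<epsilon> by (simp add: field_simps)
  ultimately have P0: "P 0 < 1 / \<epsilon>" by (simp only:)
  have "exp (1 / \<epsilon>) \<le> (\<rho>1 - \<rho>0) / h" using h(1,3) by (simp add: field_simps)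
  then have "ln (exp (1 / \<epsilon>)) \<le> ln ((\<rho>1 - \<rho>0) / h)"
    using h less by (subst ln_le_cancel_iff) auto
  then have Ph: "1 / \<epsilon> \<le> P (flux_min - h)"
    using flux_primitive_blows_up[OF h(1)] by (simp add: P_def)
  have "continuous_on {0..flux_min - h} (\<lambda>J. flux_primitive J a)" if "flux_min \<le> flux a" for a
    unfolding flux_primitive_def
  proof (intro continuous_intros ballI)
    fix J assume "J \<in> {0..flux_min - h}"
    then have "J < flux a" using that h by auto
    from abs_less_sqrt[OF this]
    show "sqrt (1/4 - J) + (a - 1/2) \<noteq> 0" "sqrt (1/4 - J) - (a - 1/2) \<noteq> 0" "2 * sqrt (1/4 - J) \<noteq> 0"
      by (auto simp del: real_sqrt_eq_0_iff)
  qed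
  then have "continuous_on {0..flux_min - h} P"
    unfolding P_def using flux_min_le[of \<rho>0] flux_min_le[of \<rho>1] less by (intro continuous_intros) auto
  then have "\<exists>J. 0 \<le> J \<and> J \<le> flux_min - h \<and> P J = 1 / \<epsilon>"
    using P0 Ph h by (intro IVT') auto
  then obtain J where J: "0 \<le> J" "J \<le> flux_min - h" "P J = 1 / \<epsilon>" by blast
  with P0 have "J \<noteq> 0" by auto
  with J h that[of J] show thesis by (simp add: P_def)
qed

lemma J_visc_eq:
  assumes \<epsilon>: "0 < \<epsilon>" and J: "J < flux_min" "flux_primitive J \<rho>1 - flux_primitive J \<rho>0 = 1 / \<epsilon>"
  shows "J_visc \<rho>0 \<rho>1 \<epsilon> = J"
  unfolding J_visc_def INF_flux
proof (rule the_equality)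
  show IJ: "J < flux_min \<and> ((\<lambda>a. \<epsilon> / (flux a - J)) has_integral 1) {\<rho>0..\<rho>1}"
    using has_integral_flux_primitive[OF J(1), of \<epsilon>] J \<epsilon> by simp
  have no: "\<not> (J1 < J2)" if "J1 < flux_min" "((\<lambda>a. \<epsilon> / (flux a - J1)) has_integral 1) {\<rho>0..\<rho>1}"
    and "J2 < flux_min" "((\<lambda>a. \<epsilon> / (flux a - J2)) has_integral 1) {\<rho>0..\<rho>1}" for J1 J2
  proof
    assume lt: "J1 < J2"
    have frac: "\<epsilon> * (b - c) / (b * c) = \<epsilon> / c - \<epsilon> / b" if "0 < b" "0 < c" for b c :: real
      using that by (simp add: field_simps)
    \<comment> \<open>A constant lower bound for the difference of the integrands: the flux is at
      most 1/4 and J1 < J2, so both denominators are at most 1/4 - J1.\<close>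
    define c where "c = \<epsilon> * (J2 - J1) / ((1/4 - J1) * (1/4 - J1))"
    have f4: "flux a \<le> 1/4" for a by (simp add: flux_sq)
    have "J1 < 1/4" using that(1) f4[of \<rho>0] by (simp add: flux_min_def)
    then have c: "0 < c" using \<epsilon> lt by (auto simp: c_def intro!: divide_pos_pos mult_pos_pos)
    have "((\<lambda>_. c) has_integral (\<rho>1 - \<rho>0) * c) {\<rho>0..\<rho>1}"
      using has_integral_const_real[of c \<rho>0 \<rho>1] less by simp
    then have "(\<rho>1 - \<rho>0) * c \<le> 1 - 1"
    proof (rule has_integral_le[OF _ has_integral_diff[OF that(4) that(2)]])
      fix a assume "a \<in> {\<rho>0..\<rho>1}"
      then have a: "J1 < flux a" "J2 < flux a" using flux_min_le[of a] that by auto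
      have "c \<le> \<epsilon> * (J2 - J1) / ((flux a - J1) * (flux a - J2))"
        unfolding c_def using a lt \<epsilon> f4[of a] by (intro divide_left_mono mult_mono mult_pos_pos) auto
      also have "\<dots> = \<epsilon> / (flux a - J2) - \<epsilon> / (flux a - J1)"
        using frac[of "flux a - J1" "flux a - J2"] a by simp
      finally show "c \<le> \<epsilon> / (flux a - J2) - \<epsilon> / (flux a - J1)" .
    qed
    moreover have "0 < (\<rho>1 - \<rho>0) * c" using less c by simp
    ultimately show False by simp
  qed
  fix J' assume "J' < flux_min \<and> ((\<lambda>a. \<epsilon> / (flux a - J')) has_integral 1) {\<rho>0..\<rho>1}"
  with IJ no[of J J'] no[of J' J] show "J' = J" by (meson linorder_neqE)
qed

end

text \<open>Since flux u - flux v = (u - v)(1 - u - v), the difference solves a linear equation, and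
  the integrating factor exp (- C) makes it constant.\<close>

lemma flux_ode_unique:
  fixes u v :: "real \<Rightarrow> real"
  assumes \<epsilon>: "\<epsilon> \<noteq> 0" and init: "u 0 = v 0"
    and u: "\<And>x. x \<in> {0..1} \<Longrightarrow> (u has_real_derivative (flux (u x) - J) / \<epsilon>) (at x within {0..1})"
    and v: "\<And>x. x \<in> {0..1} \<Longrightarrow> (v has_real_derivative (flux (v x) - J) / \<epsilon>) (at x within {0..1})"
    and x: "x \<in> {0..1}"
  shows "u x = v x"
proof -
  define c where "c x = (1 - u x - v x) / \<epsilon>" for x
  have "continuous_on {0..1} u" "continuous_on {0..1} v"
    by (rule DERIV_continuous_on, erule u, rule DERIV_continuous_on, erule v)
  then have cc: "continuous_on {0..1} c" unfolding c_def using \<epsilon> by (intro continuous_intros) auto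
  define C where "C x = integral {0..x} c" for x
  have C: "(C has_real_derivative c x) (at x within {0..1})" if "x \<in> {0..1}" for x
    using integral_has_real_derivative[OF cc that] by (simp add: C_def[abs_def])
  define w where "w x = (u x - v x) * exp (- C x)" for x
  have "(w has_derivative (\<lambda>_. 0)) (at x within {0..1})" if "x \<in> {0..1}" for x
  proof -
    have "(w has_real_derivative ((flux (u x) - J) / \<epsilon> - (flux (v x) - J) / \<epsilon>) * exp (- C x)
        + (u x - v x) * (exp (- C x) * (- c x))) (at x within {0..1})"
      unfolding w_def using that by (auto intro!: derivative_eq_intros u v C)
    also have "((flux (u x) - J) / \<epsilon> - (flux (v x) - J) / \<epsilon>) * exp (- C x)
        + (u x - v x) * (exp (- C x) * (- c x)) = 0"
      using \<epsilon> by (simp add: c_def flux_def divide_simps) (simp add: algebra_simps)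
    finally show ?thesis by (simp add: has_field_derivative_def lambda_zero)
  qed
  then have "w x = w 0"
    using x by (intro has_derivative_zero_unique[of "{0..1::real}" w]) auto
  then show ?thesis by (simp add: w_def init)
qed

section \<open>The explicit stationary solution and its minimality\<close>

context boundary_data
begin

lemma rho_visc_exists:
  assumes \<epsilon>: "0 < \<epsilon>" "\<epsilon> * mass < 1"
  obtains J where "0 < J" "J < flux_min" "rho_visc \<rho>0 \<rho>1 \<epsilon> 0 = \<rho>0" "rho_visc \<rho>0 \<rho>1 \<epsilon> 1 = \<rho>1"
    "\<And>x. x \<in> {0..1} \<Longrightarrow> \<rho>0 \<le> rho_visc \<rho>0 \<rho>1 \<epsilon> x \<and> rho_visc \<rho>0 \<rho>1 \<epsilon> x \<le> \<rho>1"
    "\<And>x. x \<in> {0..1} \<Longrightarrow> (rho_visc \<rho>0 \<rho>1 \<epsilon> has_real_derivative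
        (flux (rho_visc \<rho>0 \<rho>1 \<epsilon> x) - J) / \<epsilon>) (at x within {0..1})"
proof -
  obtain J where J: "0 < J" "J < flux_min" "flux_primitive J \<rho>1 - flux_primitive J \<rho>0 = 1 / \<epsilon>"
    by (rule ex_flux_level[OF \<epsilon>]) (rule that)
  have J_visc: "J_visc \<rho>0 \<rho>1 \<epsilon> = J" by (rule J_visc_eq[OF \<epsilon>(1) J(2,3)])
  have lt: "J < flux \<rho>0" "J < flux \<rho>1" using J by (auto simp: flux_min_def)
  define \<kappa> where "\<kappa> = sqrt (1/4 - J)"
  have \<kappa>: "0 < \<kappa>" using abs_less_sqrt[OF lt(1)] by (simp add: \<kappa>_def)
  have sq: "\<kappa>\<^sup>2 = 1/4 - J" unfolding \<kappa>_def using \<kappa> by (simp add: \<kappa>_def)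
  \<comment> \<open>Separation of variables: the primitive along the solution is x / \<epsilon> plus
    its initial value, and tanh inverts it. The increment 1 / \<epsilon> of the primitive gives u 1
    = \<rho>1.\<close>
  define u where "u x = 1/2 + \<kappa> * tanh (\<kappa> * (x / \<epsilon> + flux_primitive J \<rho>0))" for x
  have u0: "u 0 = \<rho>0" using tanh_flux_primitive[OF lt(1)] by (simp add: u_def \<kappa>_def)
  have "1 / \<epsilon> + flux_primitive J \<rho>0 = flux_primitive J \<rho>1" using J(3) by simp
  then have u1: "u 1 = \<rho>1" using tanh_flux_primitive[OF lt(2)] by (simp add: u_def \<kappa>_def)
  have mono: "u x \<le> u y" if "x \<le> y" for x y
    using that \<kappa> \<epsilon> by (simp add: u_def divide_right_mono)
  have du: "(u has_real_derivative (flux (u x) - J) / \<epsilon>) (at x within S)" for x S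
  proof -
    define T where "T = tanh (\<kappa> * (x / \<epsilon> + flux_primitive J \<rho>0))"
    have "(u has_real_derivative \<kappa> * ((1 - T\<^sup>2) * (\<kappa> * (1 / \<epsilon>)))) (at x within S)"
      unfolding u_def T_def using \<epsilon> by (auto intro!: derivative_eq_intros)
    also have "\<kappa> * ((1 - T\<^sup>2) * (\<kappa> * (1 / \<epsilon>))) = (\<kappa>\<^sup>2 - (\<kappa> * T)\<^sup>2) / \<epsilon>"
      by (simp add: power2_eq_square algebra_simps diff_divide_distrib)
    also have "\<kappa>\<^sup>2 - (\<kappa> * T)\<^sup>2 = flux (u x) - J"
      unfolding sq by (simp add: flux_sq u_def T_def)
    finally show ?thesis .
  qed
  define r where "r = restrict u {0..1}"
  have r: "r x = u x" if "x \<in> {0..1}" for x using that by (simp add: r_def)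
  have dr: "(r has_real_derivative (flux (r x) - J) / \<epsilon>) (at x within {0..1})" if "x \<in> {0..1}" for x
    using du[of x "{0..1}"] unfolding r[OF that]
    by (rule has_field_derivative_transform_within[OF _ zero_less_one that]) (simp add: r)
  have "rho_visc \<rho>0 \<rho>1 \<epsilon> = r"
    unfolding rho_visc_def J_visc
  proof (rule the_equality)
    show "r \<in> extensional {0..1} \<and> r 0 = \<rho>0 \<and>
      (\<forall>x\<in>{0..1}. \<exists>d. (r has_real_derivative d) (at x within {0..1}) \<and> flux (r x) - \<epsilon> * d = J)"
    proof (intro conjI ballI)
      fix x :: real assume x: "x \<in> {0..1}"
      show "\<exists>d. (r has_real_derivative d) (at x within {0..1}) \<and> flux (r x) - \<epsilon> * d = J"
        using dr[OF x] \<epsilon> by (intro exI[of _ "(flux (r x) - J) / \<epsilon>"]) simp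
    qed (use u0 in \<open>auto simp: r_def\<close>)
  next
    fix v assume v: "v \<in> extensional {0..1} \<and> v 0 = \<rho>0 \<and>
      (\<forall>x\<in>{0..1}. \<exists>d. (v has_real_derivative d) (at x within {0..1}) \<and> flux (v x) - \<epsilon> * d = J)"
    have dv: "(v has_real_derivative (flux (v x) - J) / \<epsilon>) (at x within {0..1})" if x: "x \<in> {0..1}" for x
    proof -
      obtain d where d: "(v has_real_derivative d) (at x within {0..1})" "flux (v x) - \<epsilon> * d = J"
        using v x by blast
      then have "d = (flux (v x) - J) / \<epsilon>" using \<epsilon> by (simp add: field_simps)
      with d show ?thesis by simp
    qed
    show "v = r"
    proof (rule extensionalityI[of _ "{0..1}"])
      show "v x = r x" if "x \<in> {0..1}" for x
        by (rule flux_ode_unique[OF _ _ dv dr that]) (use \<epsilon> v u0 r[of 0] in auto)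
    qed (use v in \<open>auto simp: r_def\<close>)
  qed
  moreover have "\<rho>0 \<le> r x \<and> r x \<le> \<rho>1" if "x \<in> {0..1}" for x
    using mono[of 0 x] mono[of x 1] u0 u1 r[OF that] that by auto
  ultimately show thesis
    using that[OF J(1,2)] dr u0 u1 r[of 0] r[of 1] by simp
qed

lemma rho_visc_minimizes:
  assumes \<epsilon>: "0 < \<epsilon>" "\<epsilon> * mass < 1"
  shows "profile (rho_visc \<rho>0 \<rho>1 \<epsilon>)"
    and "profile r \<Longrightarrow> So_visc \<rho>0 \<rho>1 \<epsilon> (abs_linf (rho_visc \<rho>0 \<rho>1 \<epsilon>)) \<le> So_visc \<rho>0 \<rho>1 \<epsilon> (abs_linf r)"
proof -
  define b where "b = rho_visc \<rho>0 \<rho>1 \<epsilon>"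
  obtain J where J: "0 < J" "J < flux_min" and b0: "b 0 = \<rho>0" and b1: "b 1 = \<rho>1"
    and bb: "\<And>x. x \<in> {0..1} \<Longrightarrow> \<rho>0 \<le> b x \<and> b x \<le> \<rho>1"
    and db: "\<And>x. x \<in> {0..1} \<Longrightarrow> (b has_real_derivative (flux (b x) - J) / \<epsilon>) (at x within {0..1})"
    by (rule rho_visc_exists[OF \<epsilon>, folded b_def]) (rule that)
  have cb: "continuous_on {0..1} b" by (rule DERIV_continuous_on) (erule db)
  have bpos: "0 < b x" "b x < 1" if "x \<in> {0..1}" for x using bb[OF that] pos less1 by auto
  have fl: "flux_min \<le> flux (b x)" if "x \<in> {0..1}" for x using bb[OF that] flux_min_le by simp
  have "b \<in> borel_measurable unit_leb"
    using borel_measurable_continuous_on_restrict[OF cb] measurable_cong_sets[OF sets_unit_leb refl] by blast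
  then have p: "profile b" using bpos by (auto simp: profile_def less_imp_le)
  then show "profile (rho_visc \<rho>0 \<rho>1 \<epsilon>)" by (simp add: b_def)
  \<comment> \<open>\<open>bdry_phi\<close> has derivative 1 / flux, so the stationary equation
    becomes \<epsilon> \<open>\<phi>\<^sub>x\<close> = 1 - J / flux, and 0 < J < flux keeps this
    within [0,1].\<close>
  have adm: "admissible \<epsilon> (\<lambda>x. bdry_phi (b x)) (\<lambda>x. (1 - J / flux (b x)) / \<epsilon>)"
  proof (rule admissible_of_derivative)
    fix x :: real assume x: "x \<in> {0..1}"
    have f: "0 < flux (b x)" "J < flux (b x)" using fl[OF x] J by auto
    have "((\<lambda>a. ln (a / (1 - a))) has_real_derivative 1 / flux (b x)) (at (b x))"
      using bpos[OF x]
      by (auto intro!: derivative_eq_intros simp: flux_def)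
    then have "(bdry_phi has_real_derivative 1 / flux (b x)) (at (b x))"
      by (simp add: bdry_phi_def[abs_def])
    from DERIV_chain2[OF this db[OF x]]
    have "((\<lambda>x. bdry_phi (b x)) has_real_derivative 1 / flux (b x) * ((flux (b x) - J) / \<epsilon>)) (at x within {0..1})" .
    also have "1 / flux (b x) * ((flux (b x) - J) / \<epsilon>) = (1 - J / flux (b x)) / \<epsilon>"
      using f \<epsilon> by (simp add: field_simps)
    finally show "((\<lambda>x. bdry_phi (b x)) has_real_derivative (1 - J / flux (b x)) / \<epsilon>) (at x within {0..1})" .
    show "0 \<le> (1 - J / flux (b x)) / \<epsilon> \<and> (1 - J / flux (b x)) / \<epsilon> \<le> 1 / \<epsilon>"
      using f J \<epsilon> by (auto simp: field_simps)
  next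
    show "continuous_on {0..1} (\<lambda>x. (1 - J / flux (b x)) / \<epsilon>)"
      using cb \<epsilon> fl flux_min_pos unfolding flux_def by (intro continuous_intros) force+
  qed (simp_all add: b0 b1)
  show "So_visc \<rho>0 \<rho>1 \<epsilon> (abs_linf (rho_visc \<rho>0 \<rho>1 \<epsilon>)) \<le> So_visc \<rho>0 \<rho>1 \<epsilon> (abs_linf r)" if "profile r"
    using stationary_minimizes[OF \<epsilon>(1) J p bb adm that] by (simp add: b_def)
qed

section \<open>Gamma-convergence\<close>

text \<open>Viscous minus inviscid value lies in an interval from
  \<open>ent (\<epsilon> * mass)\<close> to 2 \<epsilon> mass squared, both at \<rho> and for the
  normalizing constants; subtracting can cost the full length of that interval.\<close>

definition discrepancy :: "real \<Rightarrow> real" where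
  "discrepancy \<epsilon> = 2 * (\<epsilon> * mass\<^sup>2) - ent (\<epsilon> * mass)"

lemma S_visc_bounds:
  assumes \<epsilon>: "0 < \<epsilon>" "\<epsilon> * mass < 1" and \<rho>bar: "\<rho>bar \<in> stationary_inv \<rho>0 \<rho>1" and \<rho>: "\<rho> \<in> M_set"
  obtains s t where "S_visc \<rho>0 \<rho>1 \<epsilon> \<rho> = ereal s" "S_inv \<rho>0 \<rho>1 \<rho>bar \<rho> = ereal t"
    "0 \<le> s" "0 \<le> t" "\<bar>s - t\<bar> \<le> discrepancy \<epsilon>"
proof -
  let ?c = "2 * (\<epsilon> * mass\<^sup>2)" and ?e = "ent (\<epsilon> * mass)"
  obtain r where r: "profile r" "\<rho> = abs_linf r" by (rule M_set_profile[OF \<rho>]) (rule that)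
  obtain rb where rb: "profile rb" "\<rho>bar = abs_linf rb" "So_inv \<rho>0 \<rho>1 \<rho>bar = ereal (ln flux_min)"
    by (rule stationary_inv_value[OF \<rho>bar]) (rule that)
  note p = rho_visc_minimizes(1)[OF \<epsilon>]
  note le = rho_visc_minimizes(2)[OF \<epsilon>]
  have real: "\<exists>s v. So_inv \<rho>0 \<rho>1 (abs_linf q) = ereal s \<and> So_visc \<rho>0 \<rho>1 \<epsilon> (abs_linf q) = ereal v \<and>
      ln flux_min \<le> s \<and> s + ?e \<le> v \<and> v \<le> s + ?c" if q: "profile q" for q
  proof -
    obtain s where s: "So_inv \<rho>0 \<rho>1 (abs_linf q) = ereal s" "ln flux_min \<le> s"
      by (rule So_inv_real[OF q]) (rule that)
    show ?thesis
      using So_visc_le_So_inv[OF q \<epsilon>] So_inv_le_So_visc[OF q \<epsilon>] s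
      by (cases "So_visc \<rho>0 \<rho>1 \<epsilon> (abs_linf q)") auto
  qed
  obtain s v where 1: "So_inv \<rho>0 \<rho>1 \<rho> = ereal s" "So_visc \<rho>0 \<rho>1 \<epsilon> \<rho> = ereal v"
    "ln flux_min \<le> s" "s + ?e \<le> v" "v \<le> s + ?c" using real[OF r(1)] r(2) by blast
  obtain sb vb where 2: "So_inv \<rho>0 \<rho>1 \<rho>bar = ereal sb" "So_visc \<rho>0 \<rho>1 \<epsilon> \<rho>bar = ereal vb"
    "vb \<le> sb + ?c" using real[OF rb(1)] rb(2) by blast
  obtain sm m where 3: "So_visc \<rho>0 \<rho>1 \<epsilon> (abs_linf (rho_visc \<rho>0 \<rho>1 \<epsilon>)) = ereal m"
    "ln flux_min \<le> sm" "sm + ?e \<le> m" using real[OF p] by blast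
  \<comment> \<open>The viscous minimum m is bounded above by testing with \<rho>bar and below by
    the inviscid minimum ln \<open>flux_min\<close>.\<close>
  have "m \<le> v" "m \<le> vb" using le[OF r(1)] le[OF rb(1)] 1 2 3 r rb by simp_all
  moreover have "sb = ln flux_min" using rb 2 by simp
  ultimately show thesis
    using 1 2 3 by (intro that[of "v - m" "s - sb"]) (auto simp: S_visc_def S_inv_def discrepancy_def)
qed

lemma discrepancy_tendsto_0:
  assumes "\<And>n. 0 < e n" "e \<longlonglongrightarrow> 0"
  shows "(\<lambda>n. discrepancy (e n)) \<longlonglongrightarrow> 0"
proof -
  have "filterlim (\<lambda>n. e n * mass) (at_right 0) sequentially"
    unfolding filterlim_at using assms mass_pos tendsto_mult_right[OF assms(2), of mass]
    by (auto intro!: always_eventually simp: less_imp_neq[OF assms(1), symmetric])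
  from filterlim_compose[OF ent_tendsto_0 this]
  have "(\<lambda>n. ent (e n * mass)) \<longlonglongrightarrow> 0" .
  then have "(\<lambda>n. 2 * (e n * mass\<^sup>2) - ent (e n * mass)) \<longlonglongrightarrow> 2 * (0 * mass\<^sup>2) - 0"
    by (intro tendsto_intros assms)
  then show ?thesis by (simp add: discrepancy_def)
qed

lemma S_inv_lower_semicontinuous:
  assumes "\<rho>bar \<in> stationary_inv \<rho>0 \<rho>1"
  shows "lower_semicontinuous_map M_top (S_inv \<rho>0 \<rho>1 \<rho>bar)"
proof -
  have "So_inv \<rho>0 \<rho>1 \<rho>bar = ereal (ln flux_min)"
    by (rule stationary_inv_value[OF assms])
  then have "a < S_inv \<rho>0 \<rho>1 \<rho>bar \<rho> \<longleftrightarrow> a + ereal (ln flux_min) < So_inv \<rho>0 \<rho>1 \<rho>" for a \<rho>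
    by (simp add: S_inv_def ereal_less_minus)
  then show ?thesis
    using So_inv_lower_semicontinuous by (simp add: lower_semicontinuous_map_def)
qed

text \<open>The two functionals are uniformly close, so constant recovery sequences suffice and the
  liminf inequality reduces to lower semicontinuity of the limit.\<close>

lemma S_visc_Gamma_converges:
  assumes \<rho>bar: "\<rho>bar \<in> stationary_inv \<rho>0 \<rho>1" and e: "\<And>n. e n \<in> {0<..<eps0 \<rho>0 \<rho>1}" "e \<longlonglongrightarrow> 0"
  shows "Gamma_converges M_top (\<lambda>n. S_visc \<rho>0 \<rho>1 (e n)) (S_inv \<rho>0 \<rho>1 \<rho>bar)"
  unfolding Gamma_converges_def topspace_M_top
proof (intro ballI conjI allI impI)
  have e': "0 < e n" "e n * mass < 1" for n
    using e(1)[of n] mass_pos by (auto simp: eps0_def field_simps)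
  have D: "(\<lambda>n. discrepancy (e n)) \<longlonglongrightarrow> 0" using discrepancy_tendsto_0 e' e(2) by blast
  note bounds = S_visc_bounds[OF e' \<rho>bar]
  fix \<rho> assume \<rho>: "\<rho> \<in> M_set"
  obtain t where t: "S_inv \<rho>0 \<rho>1 \<rho>bar \<rho> = ereal t" using bounds[OF \<rho>, of 0] by metis
  show "\<exists>u. (\<forall>n. u n \<in> M_set) \<and> limitin M_top u \<rho> sequentially \<and>
      limsup (\<lambda>n. S_visc \<rho>0 \<rho>1 (e n) (u n)) \<le> S_inv \<rho>0 \<rho>1 \<rho>bar \<rho>"
  proof (intro exI[of _ "\<lambda>_. \<rho>"] conjI)
    have "S_visc \<rho>0 \<rho>1 (e n) \<rho> \<le> ereal (t + discrepancy (e n))" for n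
      by (rule bounds[OF \<rho>, of n]) (use t in auto)
    then have "limsup (\<lambda>n. S_visc \<rho>0 \<rho>1 (e n) \<rho>) \<le> limsup (\<lambda>n. ereal (t + discrepancy (e n)))"
      by (intro Limsup_mono always_eventually) auto
    also have "\<dots> = ereal (t + 0)"
      by (intro lim_imp_Limsup tendsto_intros D) auto
    finally show "limsup (\<lambda>n. S_visc \<rho>0 \<rho>1 (e n) \<rho>) \<le> S_inv \<rho>0 \<rho>1 \<rho>bar \<rho>" by (simp add: t)
  qed (use \<rho> in \<open>simp_all add: topspace_M_top\<close>)
  fix u assume u: "(\<forall>n. u n \<in> M_set) \<and> limitin M_top u \<rho> sequentially"
  show "S_inv \<rho>0 \<rho>1 \<rho>bar \<rho> \<le> liminf (\<lambda>n. S_visc \<rho>0 \<rho>1 (e n) (u n))"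
    unfolding le_Liminf_iff
  proof (intro allI impI)
    fix y assume "y < S_inv \<rho>0 \<rho>1 \<rho>bar \<rho>"
    then obtain q where q: "y < ereal q" "q < t" unfolding t using ereal_dense2 by force
    \<comment> \<open>The gap between q and m absorbs the discrepancy, while lower semicontinuity is
      applied at level m, still below t.\<close>
    define m where "m = (q + t) / 2"
    have m: "q < m" "m < t" using q by (auto simp: m_def)
    have "openin M_top {\<rho> \<in> M_set. ereal m < S_inv \<rho>0 \<rho>1 \<rho>bar \<rho>}"
      using S_inv_lower_semicontinuous[OF \<rho>bar]
      unfolding lower_semicontinuous_map_def topspace_M_top by blast
    then have "\<forall>\<^sub>F n in sequentially. u n \<in> {\<rho> \<in> M_set. ereal m < S_inv \<rho>0 \<rho>1 \<rho>bar \<rho>}"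
      using u \<rho> m t unfolding limitin_def by auto
    moreover have "\<forall>\<^sub>F n in sequentially. discrepancy (e n) < m - q"
      using D m by (intro order_tendstoD) auto
    ultimately show "\<forall>\<^sub>F n in sequentially. y < S_visc \<rho>0 \<rho>1 (e n) (u n)"
    proof eventually_elim
      fix n assume n: "u n \<in> {\<rho> \<in> M_set. ereal m < S_inv \<rho>0 \<rho>1 \<rho>bar \<rho>}" "discrepancy (e n) < m - q"
      from n(1) have un: "u n \<in> M_set" by simp
      have "ereal q \<le> S_visc \<rho>0 \<rho>1 (e n) (u n)"
        by (rule bounds[OF un, of n]) (use n in auto)
      with q(1) show "y < S_visc \<rho>0 \<rho>1 (e n) (u n)" by (rule less_le_trans)
    qed
  qed
qed

end

theorem theorem2p6:
  fixes \<rho>0 \<rho>1 :: real and \<rho>bar :: linf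
  assumes "0 < \<rho>0" and "\<rho>0 < \<rho>1" and "\<rho>1 < 1"
    and "\<rho>bar \<in> stationary_inv \<rho>0 \<rho>1"
  shows "(\<forall>\<epsilon>\<in>{0<..<eps0 \<rho>0 \<rho>1}. \<forall>\<rho>\<in>M_set. 0 \<le> S_visc \<rho>0 \<rho>1 \<epsilon> \<rho> \<and> S_visc \<rho>0 \<rho>1 \<epsilon> \<rho> < \<infinity>)
    \<and> (\<forall>\<rho>\<in>M_set. 0 \<le> S_inv \<rho>0 \<rho>1 \<rho>bar \<rho> \<and> S_inv \<rho>0 \<rho>1 \<rho>bar \<rho> < \<infinity>)
    \<and> Gamma_converges_at_0 M_top (eps0 \<rho>0 \<rho>1) (S_visc \<rho>0 \<rho>1) (S_inv \<rho>0 \<rho>1 \<rho>bar)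
    \<and> lower_semicontinuous_map M_top (S_inv \<rho>0 \<rho>1 \<rho>bar)"
proof -
  interpret boundary_data \<rho>0 \<rho>1 using assms by unfold_locales
  have eps: "0 < \<epsilon> \<and> \<epsilon> * mass < 1" if "\<epsilon> \<in> {0<..<eps0 \<rho>0 \<rho>1}" for \<epsilon>
    using that mass_pos by (auto simp: eps0_def field_simps)
  \<comment> \<open>The claims about \<open>S_inv\<close> mention no \<epsilon>, but their source
    does; any admissible value serves.\<close>
  have half: "eps0 \<rho>0 \<rho>1 / 2 \<in> {0<..<eps0 \<rho>0 \<rho>1}"
  proof -
    have "0 < eps0 \<rho>0 \<rho>1" using mass_pos by (simp add: eps0_def)
    then show ?thesis by simp
  qed
  have fin: "0 \<le> S_visc \<rho>0 \<rho>1 \<epsilon> \<rho> \<and> S_visc \<rho>0 \<rho>1 \<epsilon> \<rho> < \<infinity> \<and>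
      0 \<le> S_inv \<rho>0 \<rho>1 \<rho>bar \<rho> \<and> S_inv \<rho>0 \<rho>1 \<rho>bar \<rho> < \<infinity>"
    if "\<epsilon> \<in> {0<..<eps0 \<rho>0 \<rho>1}" "\<rho> \<in> M_set" for \<epsilon> \<rho>
    by (rule S_visc_bounds[OF conjunct1[OF eps[OF that(1)]] conjunct2[OF eps[OF that(1)]] assms(4) that(2)]) auto
  show ?thesis
    using fin fin[OF half] S_inv_lower_semicontinuous[OF assms(4)] S_visc_Gamma_converges[OF assms(4)]
    by (auto simp: Gamma_converges_at_0_def)
qed

end
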